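(* Consider the algorithm SBCGI described in the context for solving the stochastic simple bilevel problem described there. Suppose Assumptions (1), (2), (3) of the context hold and $f$ is convex. Then there are absolute constants $c$, $C_1$ and $C_2$ such that the following holds. Let $\delta\in(0,1)$. If the stepsizes of SBCGI are $\alpha_t=\beta_t=\rho_t=\gamma_t=(t+1)^{-1}$ and the cutting plane parameter is, with $\bar t:=\max\{t,1\}$, $$K_t=c\Big(\big(2L_lD+\tfrac32\sigma_l\big)\sqrt{2\log(6\bar t/\delta)}+D\big(2L_gD+\tfrac32\sigma_g\big)\sqrt{2\log(6\bar t d/\delta)}\Big)(t+1)^{-1/2},$$ then for every $t\ge1$, with probability at least $1-\delta$, $$g(\mathbf x_t)-g^*\le \frac{C_1\zeta}{\sqrt{t+1}}+\frac{L_gD^2\log t}{t+1}+\frac{\epsilon_g}{2},\qquad f(\mathbf x_t)-f^*\le \frac{C_2\zeta}{\sqrt{t+1}}+\frac{f(\mathbf x_0)-f^*+L_fD^2\log t}{t+1},$$ where $\zeta:=\sqrt{\log(6td/\delta)}$.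
   Context: Problem. $\|\cdot\|$ is the Euclidean norm on $\mathbb R^d$. $\mathcal Z\subset\mathbb R^d$; $\theta,\xi$ are independent random variables; $\tilde f(\cdot,\theta),\tilde g(\cdot,\xi)$ are real-valued and continuously differentiable on an open set containing $\mathcal Z$; $f(\mathbf x)=\mathbb E[\tilde f(\mathbf x,\theta)]$ and $g(\mathbf x)=\mathbb E[\tilde g(\mathbf x,\xi)]$ are continuously differentiable on $\mathcal Z$. The problem is to minimize $f(\mathbf x)$ subject to $\mathbf x\in\mathcal X_g^*:=\arg\min_{\mathbf z\in\mathcal Z}g(\mathbf z)$. Write $g^*=\min_{\mathcal Z}g$ and $f^*=\min_{\mathcal X_g^*}f$. Assumptions. (1) $\mathcal Z$ is convex and compact with diameter $D$: $\|\mathbf x-\mathbf y\|\le D$ for all $\mathbf x,\mathbf y\in\mathcal Z$. (2) For all $\mathbf x,\mathbf y\in\mathcal Z$ and all $\theta$: $\|\nabla\tilde f(\mathbf x,\theta)-\nabla\tilde f(\mathbf y,\theta)\|\le L_f\|\mathbf x-\mathbf y\|$, and $\mathbb E[\exp(\|\nabla\tilde f(\mathbf x,\theta)-\nabla f(\mathbf x)\|^2/\sigma_f^2)]\le \exp(1)$. (3) $g$ is convex; for all $\mathbf x,\mathbf y\in\mathcal Z$ and all $\xi$: $\|\nabla\tilde g(\mathbf x,\xi)-\nabla\tilde g(\mathbf y,\xi)\|\le L_g\|\mathbf x-\mathbf y\|$; and $\mathbb E[\exp(\|\nabla\tilde g(\mathbf x,\xi)-\nabla g(\mathbf x)\|^2/\sigma_g^2)]\le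 \exp(1)$, $\mathbb E[\exp(|\tilde g(\mathbf x,\xi)-g(\mathbf x)|^2/\sigma_l^2)]\le \exp(1)$. Moreover $L_l$ denotes a constant with $|\tilde g(\mathbf x,\xi)-\tilde g(\mathbf y,\xi)|\le L_l\|\mathbf x-\mathbf y\|$ for all $\mathbf x,\mathbf y\in\mathcal Z$ and all $\xi$. Algorithm SBCGI. Inputs: target accuracies $\epsilon_f,\epsilon_g>0$, $\delta>0$, stepsizes $\alpha_t,\beta_t,\rho_t,\gamma_t$, cutting plane parameters $K_t$, and a point $\mathbf x_0\in\mathcal Z$ with $g(\mathbf x_0)-g^*\le\epsilon_g/2$. At each iteration $t=0,1,2,\dots$ draw new samples $\theta_t$ of $\theta$ and $\xi_t$ of $\xi$. For $t=0$ set $\widehat{\nabla f}_0=\nabla\tilde f(\mathbf x_0,\theta_0)$, $\widehat{\nabla g}_0=\nabla\tilde g(\mathbf x_0,\xi_0)$, $\hat g_0=\tilde g(\mathbf x_0,\xi_0)$. For $t\ge1$ set $\widehat{\nabla f}_t=(1-\alpha_t)\widehat{\nabla f}_{t-1}+\nabla\tilde f(\mathbf x_t,\theta_t)-(1-\alpha_t)\nabla\tilde f(\mathbf x_{t-1},\theta_t)$, $\widehat{\nabla g}_t=(1-\beta_t)\widehat{\nabla g}_{t-1}+\nabla\tilde g(\mathbf x_t,\xi_t)-(1-\beta_t)\nabla\tilde g(\mathbf x_{t-1},\xi_t)$, $\hat g_t=(1-\rho_t)\hat g_{t-1}+\tilde g(\mathbf x_t,\xi_t)-(1-\rho_t)\tilde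 g(\mathbf x_{t-1},\xi_t)$. Then let $\hat{\mathcal X}_t=\{\mathbf s\in\mathcal Z:\langle\widehat{\nabla g}_t,\mathbf s-\mathbf x_t\rangle\le g(\mathbf x_0)-\hat g_t+K_t\}$, compute $\mathbf s_t\in\arg\min_{\mathbf s\in\hat{\mathcal X}_t}\langle\widehat{\nabla f}_t,\mathbf s\rangle$, and set $\mathbf x_{t+1}=(1-\gamma_{t+1})\mathbf x_t+\gamma_{t+1}\mathbf s_t$.
   Formalization: C_1 and C_2 cannot be absolute (rescaling f or g refutes it): here C_1 depends on D, L_g, L_l, σ_g, σ_l and C_2 on D, L_f, σ_f, but not on d, t, δ; c is absolute. The constants are chosen for given underlying sample sets. *)

theory Defs
  imports "HOL-Probability.Probability"
begin

text \<open>
  The constants whose existence is claimed must not depend on the dimension \<open>d\<close>, so \<open>d\<close> has to be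
  quantified inside the statement and cannot be a type. All Euclidean spaces are therefore taken
  inside one inner product space, the finitely supported real sequences; \<open>\<real>\<^sup>d\<close> is the set of
  sequences that vanish from index \<open>d\<close> on. Inner product, norm, topology and derivatives restricted
  to that set are the usual Euclidean ones.
\<close>

typedef fin_seq = "{x :: nat \<Rightarrow> real. finite {i. x i \<noteq> 0}}"
  morphisms coord Abs_fin_seq
  by (rule exI[of _ "\<lambda>_. 0"]) simp

setup_lifting type_definition_fin_seq

lemma finite_coord [simp]: "finite {i. coord x i \<noteq> 0}"
  using coord[of x] by simp

instantiation fin_seq :: real_vector
begin

lift_definition zero_fin_seq :: fin_seq is "\<lambda>_. 0"
  by simp

lift_definition plus_fin_seq :: "fin_seq \<Rightarrow> fin_seq \<Rightarrow> fin_seq" is "\<lambda>x y i. x i + y i"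
  subgoal for x y
    by (rule finite_subset[of _ "{i. x i \<noteq> 0} \<union> {i. y i \<noteq> 0}"]) auto
  done

lift_definition uminus_fin_seq :: "fin_seq \<Rightarrow> fin_seq" is "\<lambda>x i. - x i"
  by simp

lift_definition minus_fin_seq :: "fin_seq \<Rightarrow> fin_seq \<Rightarrow> fin_seq" is "\<lambda>x y i. x i - y i"
  subgoal for x y
    by (rule finite_subset[of _ "{i. x i \<noteq> 0} \<union> {i. y i \<noteq> 0}"]) auto
  done

lift_definition scaleR_fin_seq :: "real \<Rightarrow> fin_seq \<Rightarrow> fin_seq" is "\<lambda>r x i. r * x i"
  by (erule rev_finite_subset) auto

instance
  by standard (transfer; simp add: algebra_simps fun_eq_iff)+

end

lemmas coord_simps [simp] = zero_fin_seq.rep_eq plus_fin_seq.rep_eq uminus_fin_seq.rep_eq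
  minus_fin_seq.rep_eq scaleR_fin_seq.rep_eq

instantiation fin_seq :: real_inner
begin

definition inner_fin_seq :: "fin_seq \<Rightarrow> fin_seq \<Rightarrow> real" where
  "inner_fin_seq x y = (\<Sum>i | coord x i \<noteq> 0. coord x i * coord y i)"

definition norm_fin_seq :: "fin_seq \<Rightarrow> real" where
  "norm_fin_seq x = sqrt (inner x x)"

definition sgn_fin_seq :: "fin_seq \<Rightarrow> fin_seq" where
  "sgn_fin_seq x = x /\<^sub>R norm x"

definition dist_fin_seq :: "fin_seq \<Rightarrow> fin_seq \<Rightarrow> real" where
  "dist_fin_seq x y = norm (x - y)"

definition uniformity_fin_seq :: "(fin_seq \<times> fin_seq) filter" where
  "uniformity_fin_seq = (INF e\<in>{0 <..}. principal {(x, y). dist x y < e})"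

definition open_fin_seq :: "fin_seq set \<Rightarrow> bool" where
  "open_fin_seq U \<longleftrightarrow> (\<forall>x\<in>U. \<forall>\<^sub>F (x', y) in uniformity. x' = x \<longrightarrow> y \<in> U)"

lemma inner_fin_seq_superset:
  assumes "finite A" "{i. coord x i \<noteq> 0} \<subseteq> A"
  shows "inner x y = (\<Sum>i\<in>A. coord x i * coord y i)"
  unfolding inner_fin_seq_def using assms by (intro sum.mono_neutral_left) auto

instance
proof
  fix x y z :: fin_seq and r :: real
  let ?A = "{i. coord x i \<noteq> 0} \<union> {i. coord y i \<noteq> 0}"
  show "inner x y = inner y x"
    using inner_fin_seq_superset[of ?A x y] inner_fin_seq_superset[of ?A y x]
    by (simp add: mult.commute)
  show "inner (x + y) z = inner x z + inner y z"
    using inner_fin_seq_superset[of ?A x z] inner_fin_seq_superset[of ?A y z]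
      inner_fin_seq_superset[of ?A "x + y" z]
    by (force simp: sum.distrib distrib_right)
  show "inner (r *\<^sub>R x) y = r * inner x y"
    using inner_fin_seq_superset[of ?A x y] inner_fin_seq_superset[of ?A "r *\<^sub>R x" y]
    by (force simp: sum_distrib_left mult.assoc)
  show "0 \<le> inner x x"
    unfolding inner_fin_seq_def by (simp add: sum_nonneg)
  show "inner x x = 0 \<longleftrightarrow> x = 0"
  proof
    assume "inner x x = 0"
    then have "\<forall>i. coord x i = 0"
      unfolding inner_fin_seq_def by (subst (asm) sum_nonneg_eq_0_iff) auto
    then show "x = 0"
      by (simp add: coord_inject[symmetric] fun_eq_iff)
  qed (simp add: inner_fin_seq_def)
qed (simp_all add: norm_fin_seq_def sgn_fin_seq_def dist_fin_seq_def uniformity_fin_seq_def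
    open_fin_seq_def)

end

definition Rn :: "nat \<Rightarrow> fin_seq set" where
  "Rn d = {x. \<forall>i\<ge>d. coord x i = 0}"

lemma inner_Rn: "x \<in> Rn d \<Longrightarrow> inner x y = (\<Sum>i<d. coord x i * coord y i)"
  by (rule inner_fin_seq_superset) (auto simp: Rn_def intro: leI)

text \<open>
  \<open>h\<close> is continuously differentiable on \<open>S\<close> with gradient \<open>dh\<close>; the derivative is taken within \<open>S\<close>,
  so only the values of \<open>h\<close> on \<open>S\<close> matter.
\<close>

definition C1_on :: "'v::real_inner set \<Rightarrow> ('v \<Rightarrow> real) \<Rightarrow> ('v \<Rightarrow> 'v) \<Rightarrow> bool" where
  "C1_on S h dh \<longleftrightarrow>
     (\<forall>x\<in>S. (h has_derivative (\<lambda>v. dh x \<bullet> v)) (at x within S)) \<and> continuous_on S dh"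

definition mean_fun :: "'a measure \<Rightarrow> ('v \<Rightarrow> 'a \<Rightarrow> real) \<Rightarrow> 'v \<Rightarrow> real" where
  "mean_fun P H x = (\<integral>a. H x a \<partial>P)"

text \<open>
  Integrability is explicit because the Bochner integral of a non-integrable function is \<open>0\<close>.
\<close>

definition subgaussian :: "'a measure \<Rightarrow> ('a \<Rightarrow> real) \<Rightarrow> real \<Rightarrow> bool" where
  "subgaussian P X \<sigma> \<longleftrightarrow>
     integrable P (\<lambda>a. exp ((X a)\<^sup>2 / \<sigma>\<^sup>2)) \<and> (\<integral>a. exp ((X a)\<^sup>2 / \<sigma>\<^sup>2) \<partial>P) \<le> exp 1"

text \<open>
  A stochastic function \<open>H\<close> on \<open>Z \<subseteq> \<real>\<^sup>d\<close>, driven by a sample with law \<open>P\<close>, with gradient \<open>dH\<close>; its mean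
  has gradient \<open>dh\<close> on \<open>Z\<close>. Each \<open>H (\<cdot>, a)\<close> is continuously differentiable on a (relatively) open
  subset of \<open>\<real>\<^sup>d\<close> containing \<open>Z\<close>.
\<close>

locale stochastic_function = prob_space P for P :: "'a measure" +
  fixes d :: nat and Z :: "fin_seq set"
    and H :: "fin_seq \<Rightarrow> 'a \<Rightarrow> real" and dH :: "fin_seq \<Rightarrow> 'a \<Rightarrow> fin_seq"
    and dh :: "fin_seq \<Rightarrow> fin_seq"
  assumes sample_C1: "a \<in> space P \<Longrightarrow>
      \<exists>U. openin (top_of_set (Rn d)) U \<and> Z \<subseteq> U \<and>
          (\<forall>x\<in>U. dH x a \<in> Rn d) \<and> C1_on U (\<lambda>x. H x a) (\<lambda>x. dH x a)"
    and sample_integrable: "x \<in> Z \<Longrightarrow> integrable P (H x)"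
    and sample_grad_measurable: "x \<in> Z \<Longrightarrow> dH x \<in> borel_measurable P"
    and mean_C1: "C1_on Z (mean_fun P H) dh"
    and mean_grad_Rn: "x \<in> Z \<Longrightarrow> dh x \<in> Rn d"

text \<open>
  The problem of minimizing \<open>f = mean_fun P\<theta> F\<close> over the minimizers on \<open>Z\<close> of
  \<open>g = mean_fun P\<xi> G\<close>, with the standing assumptions. \<open>P\<theta>\<close> and \<open>P\<xi>\<close> are the laws of the two noise
  variables.
\<close>

locale stochastic_bilevel =
  upper: stochastic_function P\<theta> d Z F dF df + lower: stochastic_function P\<xi> d Z G dG dg
  for d :: nat and Z :: "fin_seq set"
    and P\<theta> :: "'a measure" and F :: "fin_seq \<Rightarrow> 'a \<Rightarrow> real"
    and dF :: "fin_seq \<Rightarrow> 'a \<Rightarrow> fin_seq" and df :: "fin_seq \<Rightarrow> fin_seq"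
    and P\<xi> :: "'b measure" and G :: "fin_seq \<Rightarrow> 'b \<Rightarrow> real"
    and dG :: "fin_seq \<Rightarrow> 'b \<Rightarrow> fin_seq" and dg :: "fin_seq \<Rightarrow> fin_seq" +
  fixes D Lf Lg Ll \<sigma>f \<sigma>g \<sigma>l :: real
  assumes dim_pos: "d \<ge> 1"
    and Lf_nonneg: "Lf \<ge> 0" and Lg_nonneg: "Lg \<ge> 0" and Ll_nonneg: "Ll \<ge> 0"
    and \<sigma>f_pos: "\<sigma>f > 0" and \<sigma>g_pos: "\<sigma>g > 0" and \<sigma>l_pos: "\<sigma>l > 0"
    and Z_Rn: "Z \<subseteq> Rn d" and Z_convex: "convex Z" and Z_compact: "compact Z"
    and Z_diameter: "\<lbrakk>x \<in> Z; y \<in> Z\<rbrakk> \<Longrightarrow> norm (x - y) \<le> D"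
    and F_smooth: "\<lbrakk>x \<in> Z; y \<in> Z; a \<in> space P\<theta>\<rbrakk> \<Longrightarrow> norm (dF x a - dF y a) \<le> Lf * norm (x - y)"
    and F_grad_noise: "x \<in> Z \<Longrightarrow> subgaussian P\<theta> (\<lambda>a. norm (dF x a - df x)) \<sigma>f"
    and g_convex: "convex_on Z (mean_fun P\<xi> G)"
    and G_smooth: "\<lbrakk>x \<in> Z; y \<in> Z; b \<in> space P\<xi>\<rbrakk> \<Longrightarrow> norm (dG x b - dG y b) \<le> Lg * norm (x - y)"
    and G_grad_noise: "x \<in> Z \<Longrightarrow> subgaussian P\<xi> (\<lambda>b. norm (dG x b - dg x)) \<sigma>g"
    and G_noise: "x \<in> Z \<Longrightarrow> subgaussian P\<xi> (\<lambda>b. \<bar>G x b - mean_fun P\<xi> G x\<bar>) \<sigma>l"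
    and G_Lipschitz: "\<lbrakk>x \<in> Z; y \<in> Z; b \<in> space P\<xi>\<rbrakk> \<Longrightarrow> \<bar>G x b - G y b\<bar> \<le> Ll * norm (x - y)"

definition lower_value :: "('v \<Rightarrow> real) \<Rightarrow> 'v set \<Rightarrow> real" where
  "lower_value g Z = Inf (g ` Z)"

definition lower_solutions :: "('v \<Rightarrow> real) \<Rightarrow> 'v set \<Rightarrow> 'v set" where
  "lower_solutions g Z = {z. is_arg_min g (\<lambda>z. z \<in> Z) z}"

definition upper_value :: "('v \<Rightarrow> real) \<Rightarrow> ('v \<Rightarrow> real) \<Rightarrow> 'v set \<Rightarrow> real" where
  "upper_value f g Z = Inf (f ` lower_solutions g Z)"

text \<open>
  The recursive estimator of the algorithm, for a stochastic function \<open>H\<close> (a gradient or a function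
  value) along the points \<open>x\<close> with the samples \<open>z\<close>; \<open>a\<close> is the stepsize sequence.
\<close>

primrec vr_estimator ::
  "(nat \<Rightarrow> real) \<Rightarrow> ('v \<Rightarrow> 'a \<Rightarrow> 'c::real_vector) \<Rightarrow> (nat \<Rightarrow> 'v) \<Rightarrow> (nat \<Rightarrow> 'a) \<Rightarrow> nat \<Rightarrow> 'c" where
  "vr_estimator a H x z 0 = H (x 0) (z 0)"
| "vr_estimator a H x z (Suc t) =
     (1 - a (Suc t)) *\<^sub>R vr_estimator a H x z t + H (x (Suc t)) (z (Suc t))
       - (1 - a (Suc t)) *\<^sub>R H (x t) (z (Suc t))"

text \<open>
  A run of SBCGI on the probability space \<open>M\<close>.

  \<open>\<F> t\<close> is the information available before the samples of iteration \<open>t\<close> are drawn; the new samples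
  \<open>(\<theta> t, \<xi> t)\<close> are independent of it, and their joint law is the product of \<open>P\<theta>\<close> and \<open>P\<xi>\<close>, which says
  that \<open>\<theta> t\<close> and \<open>\<xi> t\<close> have these laws and are independent of each other. The choice \<open>s t\<close> made at iteration
  \<open>t\<close> is known before iteration \<open>t + 1\<close>; it is otherwise an arbitrary, possibly randomized, selection.

  With unbounded noise the feasible set of the subproblem can be empty with positive probability, and
  then the minimization is meaningless; \<open>s t\<close> is an arbitrary point of \<open>Z\<close> in that case.
\<close>

locale sbcgi =
  stochastic_bilevel d Z P\<theta> F dF df P\<xi> G dG dg D Lf Lg Ll \<sigma>f \<sigma>g \<sigma>l + prob_space M
  for d :: nat and Z :: "fin_seq set"
    and P\<theta> :: "'a measure" and F :: "fin_seq \<Rightarrow> 'a \<Rightarrow> real"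
    and dF :: "fin_seq \<Rightarrow> 'a \<Rightarrow> fin_seq" and df :: "fin_seq \<Rightarrow> fin_seq"
    and P\<xi> :: "'b measure" and G :: "fin_seq \<Rightarrow> 'b \<Rightarrow> real"
    and dG :: "fin_seq \<Rightarrow> 'b \<Rightarrow> fin_seq" and dg :: "fin_seq \<Rightarrow> fin_seq"
    and D Lf Lg Ll \<sigma>f \<sigma>g \<sigma>l :: real and M :: "'w measure" +
  fixes \<epsilon>f \<epsilon>g :: real and \<alpha> \<beta> \<rho> \<gamma> K :: "nat \<Rightarrow> real" and x0 :: fin_seq
    and \<F> :: "nat \<Rightarrow> 'w measure" and \<theta> :: "nat \<Rightarrow> 'w \<Rightarrow> 'a" and \<xi> :: "nat \<Rightarrow> 'w \<Rightarrow> 'b"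
    and x s :: "nat \<Rightarrow> 'w \<Rightarrow> fin_seq"
  assumes \<epsilon>f_pos: "\<epsilon>f > 0" and \<epsilon>g_pos: "\<epsilon>g > 0"
    and x0_Z: "x0 \<in> Z"
    and x0_near_optimal: "mean_fun P\<xi> G x0 - lower_value (mean_fun P\<xi> G) Z \<le> \<epsilon>g / 2"
    and filtration: "filtration (space M) \<F>" and \<F>_sub: "subalgebra M (\<F> t)"
    and \<theta>_adapted: "\<theta> t \<in> \<F> (Suc t) \<rightarrow>\<^sub>M P\<theta>" and \<xi>_adapted: "\<xi> t \<in> \<F> (Suc t) \<rightarrow>\<^sub>M P\<xi>"
    and s_adapted: "s t \<in> borel_measurable (\<F> (Suc t))"
    and samples_law: "distr M (P\<theta> \<Otimes>\<^sub>M P\<xi>) (\<lambda>\<omega>. (\<theta> t \<omega>, \<xi> t \<omega>)) = P\<theta> \<Otimes>\<^sub>M P\<xi>"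
    and samples_fresh: "indep_set (sets (\<F> t))
      {(\<lambda>\<omega>. (\<theta> t \<omega>, \<xi> t \<omega>)) -` A \<inter> space M | A. A \<in> sets (P\<theta> \<Otimes>\<^sub>M P\<xi>)}"
    and x_0: "\<omega> \<in> space M \<Longrightarrow> x 0 \<omega> = x0"
    and x_Suc: "\<omega> \<in> space M \<Longrightarrow>
      x (Suc t) \<omega> = (1 - \<gamma> (Suc t)) *\<^sub>R x t \<omega> + \<gamma> (Suc t) *\<^sub>R s t \<omega>"
    and s_Z: "\<omega> \<in> space M \<Longrightarrow> s t \<omega> \<in> Z"
    and s_argmin: "\<omega> \<in> space M \<Longrightarrow>
      let X = (\<lambda>i. x i \<omega>);
          grad_f = vr_estimator \<alpha> dF X (\<lambda>i. \<theta> i \<omega>) t;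
          grad_g = vr_estimator \<beta> dG X (\<lambda>i. \<xi> i \<omega>) t;
          val_g = vr_estimator \<rho> G X (\<lambda>i. \<xi> i \<omega>) t;
          feasible = {z \<in> Z. grad_g \<bullet> (z - X t) \<le> mean_fun P\<xi> G x0 - val_g + K t}
      in feasible \<noteq> {} \<longrightarrow> is_arg_min (\<lambda>z. grad_f \<bullet> z) (\<lambda>z. z \<in> feasible) (s t \<omega>)"

end

theory Submission
  imports Defs
begin

text \<open>
  Multiplied by \<open>t + 1\<close>, the error of the recursive estimator with stepsizes \<open>1 / (t + 1)\<close> is a
  martingale: its \<open>k\<close>-th increment is the noise at \<open>x\<^sub>k\<close> plus \<open>k\<close> times the centred difference of
  the sampled function between \<open>x\<^sub>k\<^sub>-\<^sub>1\<close> and \<open>x\<^sub>k\<close>. Consecutive points are at distance at most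
  \<open>D / (k + 1)\<close>, so the second part is bounded by \<open>2 L D\<close> and the increment is subgaussian in norm with
  parameter \<open>2 L D + \<sigma>\<close>. An exponential inequality for such martingales in inner product spaces
  (\<open>martingale_exp_moment\<close>), whose constants do not depend on the dimension, shows that the error at
  time \<open>k\<close> exceeds \<open>5 (2 L D + \<sigma>) sqrt (2 \<Lambda> / (k + 1))\<close> with probability at most \<open>exp (1 - 2 \<Lambda>)\<close>
  (\<open>estimator_error_tail\<close>). With \<open>\<Lambda> = ln (6 max k 1 / \<delta>)\<close> this is a multiple of \<open>(\<delta> / max k 1)\<^sup>2\<close>, whose sum over
  the times \<open>k < t\<close> and over the three estimators stays below \<open>\<delta>\<close>.

  The martingale property needs sampled gradients that are unbiased. The gradient of the mean is a
  derivative within \<open>Z\<close>, so it is determined only along differences of points of \<open>Z\<close>, and the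
  sampled gradients are unbiased in these directions (\<open>grad_unbiased_span\<close>). Only inner products with
  such differences enter the analysis, so the gradient errors are projected orthogonally onto their
  span before the exponential inequality is applied (\<open>gradient_error_tail\<close>).

  On the event that all estimates before time \<open>t\<close> are accurate, \<open>K\<^sub>k\<close> dominates the error of the
  estimated linearization of \<open>g\<close>. Hence every lower-level solution is feasible for the subproblem, and
  a feasible point decreases the linearization of \<open>g\<close> to \<open>g (x\<^sub>0)\<close> up to \<open>2 K\<^sub>k\<close>. One Frank-Wolfe step then
  gives a recursion \<open>(k + 2) a\<^sub>k\<^sub>+\<^sub>1 \<le> (k + 1) a\<^sub>k + B / sqrt (k + 1)\<close> for \<open>g (x\<^sub>k) - g (x\<^sub>0)\<close> and for
  \<open>f (x\<^sub>k) - f (z)\<close> with \<open>z\<close> a lower-level solution (\<open>one_step\<close>), and summing it gives both rates.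
\<close>

section \<open>Exponential moments of subgaussian variables\<close>

text \<open>
  For a centred variable the linear term integrates to \<open>0\<close>, so its exponential moment is controlled by
  the exponential moment of its square.
\<close>
lemma exp_le_add_exp_square: "exp (y::real) \<le> y + exp (y\<^sup>2)"
proof -
  have sq: "1 + y\<^sup>2 \<le> exp (y\<^sup>2)" by (rule exp_ge_add_one_self)
  consider "\<bar>y\<bar> \<le> 1" | "y > 1" | "y < -1" by linarith
  then show ?thesis
  proof cases
    case 1
    have "exp y \<le> 1 + y + y\<^sup>2"
    proof (cases "y \<ge> 0")
      case True
      then show ?thesis using exp_bound 1 by simp
    next
      case False
      define z where "z = - y"
      have z: "0 < z" "z \<le> 1" using False 1 by (auto simp: z_def)
      have "1 \<le> (1 - z + z\<^sup>2) * (1 + z)"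
        using z by (simp add: algebra_simps power2_eq_square)
      also have "\<dots> \<le> (1 - z + z\<^sup>2) * exp z"
        using z exp_ge_add_one_self[of z] by (intro mult_left_mono) auto
      finally have "exp (- z) \<le> 1 - z + z\<^sup>2"
        by (simp add: exp_minus field_simps)
      then show ?thesis by (simp add: z_def)
    qed
    then show ?thesis using sq by linarith
  next
    case 2
    then have "y \<le> y\<^sup>2" by (simp add: power2_eq_square)
    then show ?thesis using 2 by (smt (verit) exp_le_cancel_iff)
  next
    case 3
    then have "- y \<le> y\<^sup>2" using mult_right_mono_neg[of y "-1" y] by (simp add: power2_eq_square)
    moreover have "exp y \<le> 1" using 3 by simp
    ultimately show ?thesis using sq by linarith
  qed
qed

lemma exp_convex_combination:
  fixes u v :: real
  assumes "0 \<le> q" "q \<le> 1"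
  shows "exp (q * u + (1 - q) * v) \<le> q * exp u + (1 - q) * exp v"
  using convex_onD[OF exp_convex, of "1 - q" u v] assms by simp

text \<open>
  With \<open>q = \<sigma> / (B + \<sigma>)\<close>, the ratio \<open>(B + \<bar>X\<bar>) / (B + \<sigma>)\<close> is the convex combination of \<open>\<bar>X\<bar> / \<sigma>\<close> and \<open>1\<close>
  with weights \<open>q\<close> and \<open>1 - q\<close>. Convexity of the square and of the exponential function then keeps the
  moment below \<open>exp 1\<close>.
\<close>
lemma subgaussian_add_bounded:
  assumes P: "prob_space P" and X: "subgaussian P X \<sigma>" and \<sigma>: "\<sigma> > 0" and B: "B \<ge> 0"
    and Y: "Y \<in> borel_measurable P"
    and bound: "\<And>b. b \<in> space P \<Longrightarrow> \<bar>Y b\<bar> \<le> B + \<bar>X b\<bar>"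
  shows "subgaussian P Y (B + \<sigma>)"
proof -
  interpret prob_space P by fact
  define q where "q = \<sigma> / (B + \<sigma>)"
  have q: "0 \<le> q" "q \<le> 1" using \<sigma> B by (auto simp: q_def)
  have pt: "exp ((Y b)\<^sup>2 / (B + \<sigma>)\<^sup>2) \<le> q * exp ((X b)\<^sup>2 / \<sigma>\<^sup>2) + (1 - q) * exp 1"
    if b: "b \<in> space P" for b
  proof -
    define n where "n = \<bar>X b\<bar> / \<sigma>"
    have "(\<bar>Y b\<bar> / (B + \<sigma>))\<^sup>2 \<le> ((B + \<bar>X b\<bar>) / (B + \<sigma>))\<^sup>2"
      using bound[OF b] \<sigma> B by (intro power_mono divide_right_mono) auto
    also have "(B + \<bar>X b\<bar>) / (B + \<sigma>) = q * n + (1 - q)"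
      using \<sigma> B by (simp add: q_def n_def divide_simps)
    also have "(q * n + (1 - q))\<^sup>2 \<le> q * n\<^sup>2 + (1 - q)"
    proof -
      have "q * n\<^sup>2 + (1 - q) - (q * n + (1 - q))\<^sup>2 = q * (1 - q) * (n - 1)\<^sup>2"
        by (simp add: power2_eq_square algebra_simps)
      moreover have "\<dots> \<ge> 0" using q by simp
      ultimately show ?thesis by linarith
    qed
    finally have "(Y b)\<^sup>2 / (B + \<sigma>)\<^sup>2 \<le> q * n\<^sup>2 + (1 - q) * 1" by (simp add: power_divide)
    then have "exp ((Y b)\<^sup>2 / (B + \<sigma>)\<^sup>2) \<le> exp (q * n\<^sup>2 + (1 - q) * 1)" by simp
    also have "\<dots> \<le> q * exp (n\<^sup>2) + (1 - q) * exp 1"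
      by (rule exp_convex_combination[OF q])
    finally show ?thesis by (simp add: n_def power_divide)
  qed
  have int: "integrable P (\<lambda>b. q * exp ((X b)\<^sup>2 / \<sigma>\<^sup>2) + (1 - q) * exp 1)"
    using X by (auto simp: subgaussian_def)
  have intY: "integrable P (\<lambda>b. exp ((Y b)\<^sup>2 / (B + \<sigma>)\<^sup>2))"
    by (rule Bochner_Integration.integrable_bound[OF int]) (use Y in \<open>auto intro!: AE_I2 intro: order_trans[OF pt abs_ge_self]\<close>)
  have "(\<integral>b. exp ((Y b)\<^sup>2 / (B + \<sigma>)\<^sup>2) \<partial>P) \<le> (\<integral>b. q * exp ((X b)\<^sup>2 / \<sigma>\<^sup>2) + (1 - q) * exp 1 \<partial>P)"
    by (rule integral_mono[OF intY int pt])
  also have "\<dots> = q * (\<integral>b. exp ((X b)\<^sup>2 / \<sigma>\<^sup>2) \<partial>P) + (1 - q) * exp 1"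
    using X by (simp add: subgaussian_def prob_space)
  also have "\<dots> \<le> q * exp 1 + (1 - q) * exp 1"
    using X q by (intro add_right_mono mult_left_mono) (auto simp: subgaussian_def)
  finally show ?thesis using intY by (simp add: subgaussian_def algebra_simps)
qed

text \<open>
  Jensen's inequality for the concave power \<open>q\<close>, in the form of the tangent bound at the value
  \<open>exp 1\<close>.
\<close>
lemma subgaussian_exp_moment:
  assumes P: "prob_space P" and N: "subgaussian P N \<sigma>" "N \<in> borel_measurable P" and \<sigma>: "\<sigma> > 0"
    and q: "0 \<le> q" "q \<le> 1"
  shows "integrable P (\<lambda>b. exp (q * ((N b)\<^sup>2 / \<sigma>\<^sup>2)))"
    and "(\<integral>b. exp (q * ((N b)\<^sup>2 / \<sigma>\<^sup>2)) \<partial>P) \<le> exp q"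
proof -
  interpret prob_space P by fact
  let ?E = "\<lambda>b. exp ((N b)\<^sup>2 / \<sigma>\<^sup>2)"
  have pt: "exp (q * ((N b)\<^sup>2 / \<sigma>\<^sup>2)) \<le> exp q * (q * (?E b / exp 1) + (1 - q))" for b
  proof -
    have "exp (q * ((N b)\<^sup>2 / \<sigma>\<^sup>2)) = exp q * exp (q * ((N b)\<^sup>2 / \<sigma>\<^sup>2 - 1) + (1 - q) * 0)"
      unfolding exp_add[symmetric] by (simp add: algebra_simps)
    also have "\<dots> \<le> exp q * (q * exp ((N b)\<^sup>2 / \<sigma>\<^sup>2 - 1) + (1 - q) * exp 0)"
      by (intro mult_left_mono exp_convex_combination[OF q]) simp
    finally show ?thesis by (simp add: exp_diff)
  qed
  have int: "integrable P (\<lambda>b. exp q * (q * (?E b / exp 1) + (1 - q)))"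
    using N by (auto simp: subgaussian_def)
  show i: "integrable P (\<lambda>b. exp (q * ((N b)\<^sup>2 / \<sigma>\<^sup>2)))"
    by (rule Bochner_Integration.integrable_bound[OF int]) (use N in \<open>auto intro!: AE_I2 intro: order_trans[OF pt abs_ge_self] simp del: times_divide_eq_right\<close>)
  have "(\<integral>b. exp (q * ((N b)\<^sup>2 / \<sigma>\<^sup>2)) \<partial>P) \<le> (\<integral>b. exp q * (q * (?E b / exp 1) + (1 - q)) \<partial>P)"
    by (rule integral_mono[OF i int pt])
  also have "\<dots> = exp q * (q * ((\<integral>b. ?E b \<partial>P) / exp 1) + (1 - q))"
    using N by (simp add: subgaussian_def prob_space)
  also have "\<dots> \<le> exp q * (q * 1 + (1 - q))"
    using N q by (intro mult_left_mono add_right_mono) (auto simp: subgaussian_def)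
  finally show "(\<integral>b. exp (q * ((N b)\<^sup>2 / \<sigma>\<^sup>2)) \<partial>P) \<le> exp q" by simp
qed

lemma subgaussian_integrable:
  assumes P: "prob_space P" and N: "subgaussian P N \<sigma>" "N \<in> borel_measurable P" and \<sigma>: "\<sigma> > 0"
  shows "integrable P N"
proof (rule Bochner_Integration.integrable_bound)
  show "integrable P (\<lambda>b. \<sigma> * exp ((N b)\<^sup>2 / \<sigma>\<^sup>2))"
    using N by (simp add: subgaussian_def)
  have "\<bar>N b\<bar> \<le> \<sigma> * exp ((N b)\<^sup>2 / \<sigma>\<^sup>2)" for b
  proof -
    have "\<bar>N b\<bar> / \<sigma> \<le> 1 + (\<bar>N b\<bar> / \<sigma>)\<^sup>2"
      using sum_squares_bound[of "\<bar>N b\<bar> / \<sigma>" 1] \<sigma> by (smt (verit) divide_nonneg_pos power_one)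
    also have "\<dots> \<le> exp ((\<bar>N b\<bar> / \<sigma>)\<^sup>2)" by (rule exp_ge_add_one_self)
    finally show ?thesis using \<sigma> by (simp add: field_simps power_divide)
  qed
  then show "AE b in P. norm (N b) \<le> norm (\<sigma> * exp ((N b)\<^sup>2 / \<sigma>\<^sup>2))"
    using \<sigma> by (auto simp: abs_mult)
qed (use N in auto)


text \<open>
  One step of the martingale bound, for the potential \<open>\<Phi> v = exp (\<tau> sqrt (1 / \<tau>\<^sup>2 + \<parallel>v\<parallel>\<^sup>2))\<close>: here \<open>r\<close>
  stands for \<open>\<parallel>v\<parallel>\<close>, \<open>Y\<close> for the inner product of \<open>v\<close> with the increment and \<open>N\<close> for the norm of the
  increment. The potential is a smooth version of \<open>exp (\<tau> \<parallel>v\<parallel>)\<close>: adding the increment changes its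
  exponent by the linear term \<open>Y / h\<close>, which has mean \<open>0\<close>, and a quadratic term,
  with \<open>h = sqrt (1 / \<tau>\<^sup>2 + r\<^sup>2)\<close>. If \<open>\<tau> \<sigma>\<close> is at most
  \<open>1/2\<close>, both have exponential moments. For larger \<open>\<tau>\<close> the quadratic term need not have one, but
  then the exponent is bounded by the Lipschitz property of the square root, and \<open>\<tau> N\<close> by
  \<open>\<tau>\<^sup>2 \<sigma>\<^sup>2 / 4 + N\<^sup>2 / \<sigma>\<^sup>2\<close>.
\<close>
lemma exp_potential_step:
  fixes N Y :: "'a \<Rightarrow> real"
  assumes P: "prob_space P"
    and N[measurable]: "N \<in> borel_measurable P" and Y[measurable]: "Y \<in> borel_measurable P"
    and sg: "subgaussian P N \<sigma>" and \<sigma>: "\<sigma> > 0" and lam: "\<tau> > 0" and r: "r \<ge> 0"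
    and N0: "\<And>b. b \<in> space P \<Longrightarrow> 0 \<le> N b"
    and YN: "\<And>b. b \<in> space P \<Longrightarrow> \<bar>Y b\<bar> \<le> r * N b"
    and mean: "(\<integral>b. Y b \<partial>P) = 0"
  shows "(\<integral>\<^sup>+b. ennreal (exp (\<tau> * sqrt (1 / \<tau>\<^sup>2 + (r\<^sup>2 + 2 * Y b + (N b)\<^sup>2)))) \<partial>P)
    \<le> ennreal (exp (5 * \<tau>\<^sup>2 * \<sigma>\<^sup>2) * exp (\<tau> * sqrt (1 / \<tau>\<^sup>2 + r\<^sup>2)))"
proof -
  interpret prob_space P by fact
  define h where "h = sqrt (1 / \<tau>\<^sup>2 + r\<^sup>2)"
  have h2: "h\<^sup>2 = 1 / \<tau>\<^sup>2 + r\<^sup>2" unfolding h_def using lam by simp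
  have hpos: "h > 0" unfolding h_def using lam by (simp add: add_pos_nonneg)
  have hr: "r \<le> h" unfolding h_def using lam by (intro real_le_rsqrt) simp
  have hl: "1 \<le> \<tau> * h"
  proof -
    have "1 / \<tau> \<le> h" unfolding h_def by (intro real_le_rsqrt) (simp add: power_divide)
    then show ?thesis using lam by (simp add: field_simps)
  qed
  have rewr: "1 / \<tau>\<^sup>2 + (r\<^sup>2 + 2 * Y b + (N b)\<^sup>2) = h\<^sup>2 + 2 * Y b + (N b)\<^sup>2" for b
    using h2 by simp
  define q where "q = 4 * \<tau>\<^sup>2 * \<sigma>\<^sup>2"
  have q0: "q \<ge> 0" by (simp add: q_def)
  let ?W = "\<lambda>b. exp (\<tau> * sqrt (h\<^sup>2 + 2 * Y b + (N b)\<^sup>2))"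
  have "(\<integral>\<^sup>+b. ennreal (?W b) \<partial>P) \<le> ennreal (exp (5 * \<tau>\<^sup>2 * \<sigma>\<^sup>2) * exp (\<tau> * h))"
  proof (cases "q \<le> 1")
    case True
    let ?R = "\<lambda>b. exp (\<tau> * h) * ((2 * \<tau> / h * Y b + exp (q * ((N b)\<^sup>2 / \<sigma>\<^sup>2)) + exp (q / 4 * ((N b)\<^sup>2 / \<sigma>\<^sup>2))) / 2)"
    have pt: "?W b \<le> ?R b" if b: "b \<in> space P" for b
    proof -
      define u where "u = Y b / h"
      have uN: "\<bar>u\<bar> \<le> N b"
      proof -
        have "\<bar>Y b\<bar> \<le> h * N b" using YN[OF b] mult_right_mono[OF hr N0[OF b]] by linarith
        then show ?thesis using hpos by (simp add: u_def field_simps)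
      qed
      \<comment> \<open>the square root lies below its tangent at \<open>h\<^sup>2\<close>\<close>
      have "sqrt (h\<^sup>2 + 2 * Y b + (N b)\<^sup>2) \<le> h + (2 * Y b + (N b)\<^sup>2) / (2 * h)" (is "_ \<le> ?t")
      proof (rule real_le_lsqrt)
        have e: "2 * Y b = 2 * h * u" using hpos by (simp add: u_def)
        have u2: "- N b \<le> u" using uN by linarith
        have "?t = h + u + (N b)\<^sup>2 / (2 * h)"
          unfolding e using hpos by (simp add: field_simps)
        also have "\<dots> \<ge> h - N b + (N b)\<^sup>2 / (2 * h)" using u2 by linarith
        also have "h - N b + (N b)\<^sup>2 / (2 * h) = ((h - N b)\<^sup>2 + h\<^sup>2) / (2 * h)"
          using hpos by (simp add: field_simps power2_eq_square)
        finally show "0 \<le> ?t"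
          using hpos by (smt (verit) divide_nonneg_pos sum_power2_ge_zero)
        have "?t\<^sup>2 = h\<^sup>2 + (2 * Y b + (N b)\<^sup>2) + ((2 * Y b + (N b)\<^sup>2) / (2 * h))\<^sup>2"
          using hpos by (simp add: power2_sum)
        then show "h\<^sup>2 + 2 * Y b + (N b)\<^sup>2 \<le> ?t\<^sup>2" by simp
      qed
      also have "\<dots> = h + u + (N b)\<^sup>2 / (2 * h)" using hpos by (simp add: u_def field_simps)
      finally have "\<tau> * sqrt (h\<^sup>2 + 2 * Y b + (N b)\<^sup>2) \<le> \<tau> * (h + u + (N b)\<^sup>2 / (2 * h))"
        using lam by simp
      also have "\<dots> \<le> \<tau> * h + \<tau> * u + \<tau>\<^sup>2 * (N b)\<^sup>2 / 2"
      proof -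
        have "\<tau> / (2 * h) \<le> \<tau>\<^sup>2 / 2"
          using mult_left_mono[OF hl, of \<tau>] lam hpos by (simp add: field_simps power2_eq_square)
        from mult_right_mono[OF this, of "(N b)\<^sup>2"] show ?thesis by (simp add: algebra_simps)
      qed
      finally have "?W b \<le> exp (\<tau> * h) * exp (1 / 2 * (2 * (\<tau> * u)) + (1 - 1 / 2) * (\<tau>\<^sup>2 * (N b)\<^sup>2))"
        unfolding exp_add[symmetric] by simp
      \<comment> \<open>convexity separates the centred linear term from the quadratic one\<close>
      also have "\<dots> \<le> exp (\<tau> * h) * (1 / 2 * exp (2 * (\<tau> * u)) + (1 - 1 / 2) * exp (\<tau>\<^sup>2 * (N b)\<^sup>2))"
        by (intro mult_left_mono exp_convex_combination) auto
      also have "\<dots> \<le> exp (\<tau> * h) * (1 / 2 * (2 * (\<tau> * u) + exp (4 * \<tau>\<^sup>2 * (N b)\<^sup>2)) + (1 - 1 / 2) * exp (\<tau>\<^sup>2 * (N b)\<^sup>2))"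
      proof -
        have "u\<^sup>2 \<le> (N b)\<^sup>2" using uN by (simp add: abs_le_square_iff[symmetric] N0[OF b])
        then have "\<tau>\<^sup>2 * u\<^sup>2 \<le> \<tau>\<^sup>2 * (N b)\<^sup>2" by (intro mult_left_mono) auto
        then have "exp ((2 * (\<tau> * u))\<^sup>2) \<le> exp (4 * \<tau>\<^sup>2 * (N b)\<^sup>2)" by (simp add: power_mult_distrib)
        with exp_le_add_exp_square[of "2 * (\<tau> * u)"]
        have "exp (2 * (\<tau> * u)) \<le> 2 * (\<tau> * u) + exp (4 * \<tau>\<^sup>2 * (N b)\<^sup>2)" by linarith
        then show ?thesis by (intro mult_left_mono add_right_mono) auto
      qed
      also have "\<dots> = ?R b" using \<sigma> by (simp add: q_def u_def field_simps)
      finally show ?thesis .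
    qed
    have m1: "integrable P (\<lambda>b. exp (q * ((N b)\<^sup>2 / \<sigma>\<^sup>2)))" "(\<integral>b. exp (q * ((N b)\<^sup>2 / \<sigma>\<^sup>2)) \<partial>P) \<le> exp q"
      using subgaussian_exp_moment[OF P sg N \<sigma> q0 True] by auto
    have m2: "integrable P (\<lambda>b. exp (q / 4 * ((N b)\<^sup>2 / \<sigma>\<^sup>2)))" "(\<integral>b. exp (q / 4 * ((N b)\<^sup>2 / \<sigma>\<^sup>2)) \<partial>P) \<le> exp (q / 4)"
      using subgaussian_exp_moment[OF P sg N \<sigma>, of "q / 4"] True q0 by auto
    have Yi: "integrable P Y"
    proof (rule Bochner_Integration.integrable_bound)
      show "integrable P (\<lambda>b. r * N b)" using subgaussian_integrable[OF P sg N \<sigma>] by simp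
      show "AE b in P. norm (Y b) \<le> norm (r * N b)"
        using YN by (intro AE_I2) (simp, meson abs_ge_self order_trans)
    qed simp
    have Ri: "integrable P ?R" using m1 m2 Yi by (intro integrable_mult_right integrable_divide integrable_add) auto
    have "(\<integral>\<^sup>+b. ennreal (?W b) \<partial>P) \<le> (\<integral>\<^sup>+b. ennreal (?R b) \<partial>P)"
      using pt by (intro nn_integral_mono) (rule ennreal_leI)
    also have "\<dots> = ennreal (\<integral>b. ?R b \<partial>P)"
      using pt by (intro nn_integral_eq_integral Ri AE_I2) (meson exp_ge_zero order_trans)
    also have "(\<integral>b. ?R b \<partial>P) \<le> exp (5 * \<tau>\<^sup>2 * \<sigma>\<^sup>2) * exp (\<tau> * h)"
    proof -
      have "(\<integral>b. ?R b \<partial>P) = exp (\<tau> * h) * ((2 * \<tau> / h * (\<integral>b. Y b \<partial>P) + (\<integral>b. exp (q * ((N b)\<^sup>2 / \<sigma>\<^sup>2)) \<partial>P) + (\<integral>b. exp (q / 4 * ((N b)\<^sup>2 / \<sigma>\<^sup>2)) \<partial>P)) / 2)"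
        using m1(1) m2(1) Yi by (simp del: times_divide_eq_right times_divide_eq_left)
      also have "\<dots> \<le> exp (\<tau> * h) * ((exp q + exp q) / 2)"
      proof -
        have "exp (q / 4) \<le> exp q" using q0 by simp
        then have "2 * \<tau> / h * (\<integral>b. Y b \<partial>P) + (\<integral>b. exp (q * ((N b)\<^sup>2 / \<sigma>\<^sup>2)) \<partial>P)
            + (\<integral>b. exp (q / 4 * ((N b)\<^sup>2 / \<sigma>\<^sup>2)) \<partial>P) \<le> exp q + exp q"
          unfolding mean using m1(2) m2(2) by linarith
        then show ?thesis by (intro mult_left_mono divide_right_mono) auto
      qed
      also have "\<dots> \<le> exp (\<tau> * h) * exp (5 * \<tau>\<^sup>2 * \<sigma>\<^sup>2)"
        using q0 by (intro mult_left_mono) (auto simp: q_def)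
      finally show ?thesis by (simp add: mult.commute)
    qed
    finally show ?thesis by (simp add: ennreal_leI)
  next
    case False
    let ?R = "\<lambda>b. exp (\<tau> * h) * exp (q / 16) * exp ((N b)\<^sup>2 / \<sigma>\<^sup>2)"
    have pt: "?W b \<le> ?R b" if b: "b \<in> space P" for b
    proof -
      have "sqrt (h\<^sup>2 + 2 * Y b + (N b)\<^sup>2) \<le> h + N b"
      proof (rule real_le_lsqrt)
        show "0 \<le> h + N b" using hpos N0[OF b] by simp
        have "\<bar>Y b\<bar> \<le> h * N b" using YN[OF b] mult_right_mono[OF hr N0[OF b]] by linarith
        then show "h\<^sup>2 + 2 * Y b + (N b)\<^sup>2 \<le> (h + N b)\<^sup>2" by (simp add: power2_sum)
      qed
      then have "\<tau> * sqrt (h\<^sup>2 + 2 * Y b + (N b)\<^sup>2) \<le> \<tau> * h + \<tau> * N b"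
        using lam by (simp add: distrib_left[symmetric])
      also have "\<tau> * N b \<le> q / 16 + (N b)\<^sup>2 / \<sigma>\<^sup>2"
      proof -
        have "0 \<le> (\<tau> * \<sigma> / 2 - N b / \<sigma>)\<^sup>2" by simp
        also have "\<dots> = q / 16 + (N b)\<^sup>2 / \<sigma>\<^sup>2 - \<tau> * N b"
          using \<sigma> by (simp add: power2_diff q_def power_mult_distrib power_divide)
        finally show ?thesis by simp
      qed
      finally show ?thesis unfolding exp_add[symmetric] by simp
    qed
    have "(\<integral>\<^sup>+b. ennreal (?W b) \<partial>P) \<le> (\<integral>\<^sup>+b. ennreal (?R b) \<partial>P)"
      using pt by (intro nn_integral_mono) (rule ennreal_leI)
    also have "\<dots> = ennreal (\<integral>b. ?R b \<partial>P)"
      using sg by (intro nn_integral_eq_integral) (auto simp: subgaussian_def)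
    also have "(\<integral>b. ?R b \<partial>P) \<le> exp (\<tau> * h) * exp (q / 16) * exp 1"
      using sg by (auto simp: subgaussian_def)
    also have "\<dots> \<le> exp (5 * \<tau>\<^sup>2 * \<sigma>\<^sup>2) * exp (\<tau> * h)"
    proof -
      have "5 * \<tau>\<^sup>2 * \<sigma>\<^sup>2 = 5 / 4 * q" by (simp add: q_def)
      then have "q / 16 + 1 \<le> 5 * \<tau>\<^sup>2 * \<sigma>\<^sup>2" using False by linarith
      then show ?thesis unfolding exp_add[symmetric] exp_le_cancel_iff by linarith
    qed
    finally show ?thesis by (simp add: ennreal_leI)
  qed
  then show ?thesis unfolding rewr h_def .
qed

section \<open>Fresh samples and martingale tails\<close>

text \<open>
  A function of a random point and a sample that is continuous in the point and measurable in the
  sample is jointly measurable. Finite nets of the compact set replace \<open>X\<close> by points with countably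
  many values, for which this is clear, and the nets are refined. Measurability of \<open>X\<close> is only asked
  for its distances to fixed points, since this is what can be computed from coordinates.
\<close>
lemma borel_measurable_random_point:
  fixes X :: "'w \<Rightarrow> 'v::metric_space" and \<phi> :: "'v \<Rightarrow> 'b \<Rightarrow> real"
  assumes Z: "compact Z" and XZ: "\<And>\<omega>. \<omega> \<in> space N \<Longrightarrow> X \<omega> \<in> Z"
    and X: "\<And>p. p \<in> Z \<Longrightarrow> (\<lambda>\<omega>. dist (X \<omega>) p) \<in> borel_measurable N"
    and \<phi>: "\<And>p. p \<in> Z \<Longrightarrow> \<phi> p \<in> borel_measurable P"
    and cont: "\<And>b. b \<in> space P \<Longrightarrow> continuous_on Z (\<lambda>p. \<phi> p b)"
  shows "(\<lambda>(\<omega>, b). \<phi> (X \<omega>) b) \<in> borel_measurable (N \<Otimes>\<^sub>M P)"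
proof (cases "space N = {}")
  case True
  then show ?thesis by (auto simp: measurable_def space_pair_measure intro: sets.countable)
next
  case False
  then obtain \<omega>0 where "\<omega>0 \<in> space N" by auto
  then have "Z \<noteq> {}" using XZ by auto
  have "\<exists>k. finite k \<and> k \<subseteq> Z \<and> Z \<subseteq> (\<Union>p\<in>k. ball p (1 / (real n + 1)))" for n
    using seq_compact_imp_totally_bounded[of Z] Z by (simp add: compact_eq_seq_compact_metric)
  then obtain k where k: "\<And>n. finite (k n)" "\<And>n. k n \<subseteq> Z"
      "\<And>n. Z \<subseteq> (\<Union>p\<in>k n. ball p (1 / (real n + 1)))"
    by metis
  have kne: "k n \<noteq> {}" for n using k(3)[of n] \<open>Z \<noteq> {}\<close> by auto
  define p where "p n i = from_nat_into (k n) i" for n i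
  have pZ: "p n i \<in> Z" for n i using from_nat_into[OF kne] k(2) by (auto simp: p_def)
  define idx where "idx n \<omega> = (LEAST i. dist (X \<omega>) (p n i) < 1 / (real n + 1))" for n \<omega>
  have idx: "dist (X \<omega>) (p n (idx n \<omega>)) < 1 / (real n + 1)" if w: "\<omega> \<in> space N" for n \<omega>
    unfolding idx_def
  proof (rule LeastI_ex)
    obtain y where y: "y \<in> k n" "dist y (X \<omega>) < 1 / (real n + 1)"
      using k(3)[of n] XZ[OF w] by auto
    then obtain i where "p n i = y"
      using from_nat_into_surj[OF countable_finite[OF k(1)]] by (auto simp: p_def)
    then show "\<exists>i. dist (X \<omega>) (p n i) < 1 / (real n + 1)" using y by (auto simp: dist_commute)
  qed
  have idx_meas: "idx n \<in> measurable N (count_space UNIV)" for n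
  proof -
    have [measurable]: "(\<lambda>\<omega>. dist (X \<omega>) (p n i)) \<in> borel_measurable N" for i by (rule X[OF pZ])
    show ?thesis unfolding idx_def by measurable
  qed
  show ?thesis
  proof (rule borel_measurable_LIMSEQ_real)
    fix n
    have "(\<lambda>y. \<phi> (p n i) (snd y)) \<in> borel_measurable (N \<Otimes>\<^sub>M P)" for i
      using measurable_compose[OF measurable_snd \<phi>[OF pZ]] .
    moreover have "(\<lambda>y. idx n (fst y)) \<in> measurable (N \<Otimes>\<^sub>M P) (count_space UNIV)"
      using measurable_compose[OF measurable_fst idx_meas] .
    ultimately show "(\<lambda>y. \<phi> (p n (idx n (fst y))) (snd y)) \<in> borel_measurable (N \<Otimes>\<^sub>M P)"
      by (rule measurable_compose_countable)
  next
    fix y assume "y \<in> space (N \<Otimes>\<^sub>M P)"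
    then have y: "fst y \<in> space N" "snd y \<in> space P" by (auto simp: space_pair_measure)
    have "(\<lambda>n. p n (idx n (fst y))) \<longlonglongrightarrow> X (fst y)"
    proof (rule metric_tendsto_imp_tendsto)
      show "(\<lambda>n. 1 / (real n + 1)) \<longlonglongrightarrow> 0" using LIMSEQ_Suc[OF lim_1_over_n] by (simp add: add.commute)
      show "\<forall>\<^sub>F n in sequentially. dist (p n (idx n (fst y))) (X (fst y)) \<le> dist (1 / (real n + 1)) 0"
        using idx[OF y(1)] by (auto simp: dist_commute intro!: always_eventually less_imp_le)
    qed
    then show "(\<lambda>n. \<phi> (p n (idx n (fst y))) (snd y)) \<longlonglongrightarrow> (case y of (\<omega>, b) \<Rightarrow> \<phi> (X \<omega>) b)"
      unfolding case_prod_beta'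
      by (rule continuous_on_tendsto_compose[OF cont[OF y(2)] _ XZ[OF y(1)] always_eventually])
        (simp add: pZ)
  qed
qed

text \<open>
  Samples \<open>z t\<close> that have law \<open>P\<close> and are independent of the past \<open>\<F> t\<close>. Taking \<open>A = space M\<close> in the
  product formula gives the law of \<open>z t\<close>.
\<close>
locale fresh_sampling = prob_space M + P: prob_space P for M :: "'w measure" and P :: "'b measure" +
  fixes \<F> :: "nat \<Rightarrow> 'w measure" and z :: "nat \<Rightarrow> 'w \<Rightarrow> 'b"
  assumes filt: "filtration (space M) \<F>" and sub: "subalgebra M (\<F> t)"
    and adapted: "z t \<in> \<F> (Suc t) \<rightarrow>\<^sub>M P"
    and fresh: "A \<in> sets (\<F> t) \<Longrightarrow> B \<in> sets P \<Longrightarrow>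
      prob (A \<inter> (z t -` B \<inter> space M)) = prob A * P.prob B"
begin

lemma space_\<F> [simp]: "space (\<F> t) = space M"
  using sub[of t] by (simp add: subalgebra_def)

lemma measurable_\<F>_mono: "f \<in> \<F> j \<rightarrow>\<^sub>M A \<Longrightarrow> j \<le> k \<Longrightarrow> f \<in> \<F> k \<rightarrow>\<^sub>M A"
  by (rule measurable_from_subalg[of _ "\<F> j"])
    (auto simp: subalgebra_def filtration.sets_F_mono[OF filt])

lemma measurable_\<F>_M: "f \<in> \<F> j \<rightarrow>\<^sub>M A \<Longrightarrow> f \<in> M \<rightarrow>\<^sub>M A"
  by (rule measurable_from_subalg[OF sub])

lemma measurable_sample: "(\<lambda>\<omega>. (\<omega>, z t \<omega>)) \<in> \<F> (Suc t) \<rightarrow>\<^sub>M \<F> t \<Otimes>\<^sub>M P"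
  by (rule measurable_Pair[OF measurable_\<F>_mono[OF measurable_ident_sets[OF refl]] adapted]) simp

text \<open>
  The joint law of the past and the fresh sample is a product measure. This replaces conditional
  expectations throughout: the past is frozen while the sample is integrated out.
\<close>
lemma nn_integral_fresh_sample:
  assumes h: "h \<in> borel_measurable (\<F> t \<Otimes>\<^sub>M P)"
  shows "(\<integral>\<^sup>+\<omega>. h (\<omega>, z t \<omega>) \<partial>M) = (\<integral>\<^sup>+\<omega>. \<integral>\<^sup>+b. h (\<omega>, b) \<partial>P \<partial>M)"
proof -
  let ?F = "distr M (\<F> t) (\<lambda>\<omega>. \<omega>)"
  have id: "(\<lambda>\<omega>. \<omega>) \<in> M \<rightarrow>\<^sub>M \<F> t"
    by (rule measurable_\<F>_M[OF measurable_ident_sets[OF refl]])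
  have pair: "(\<lambda>\<omega>. (\<omega>, z t \<omega>)) \<in> M \<rightarrow>\<^sub>M \<F> t \<Otimes>\<^sub>M P" by (rule measurable_\<F>_M[OF measurable_sample])
  have joint: "?F \<Otimes>\<^sub>M P = distr M (\<F> t \<Otimes>\<^sub>M P) (\<lambda>\<omega>. (\<omega>, z t \<omega>))"
  proof (rule pair_measure_eqI)
    show "sigma_finite_measure ?F"
      by (intro prob_space_imp_sigma_finite prob_space_distr id)
    show "sigma_finite_measure P" ..
    show "sets (?F \<Otimes>\<^sub>M P) = sets (distr M (\<F> t \<Otimes>\<^sub>M P) (\<lambda>\<omega>. (\<omega>, z t \<omega>)))"
      by (simp cong: sets_pair_measure_cong)
    fix A B assume "A \<in> sets ?F" and B: "B \<in> sets P"
    then have A: "A \<in> sets (\<F> t)" by simp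
    then have AM: "A \<subseteq> space M" using sets.sets_into_space by fastforce
    have "emeasure (distr M (\<F> t \<Otimes>\<^sub>M P) (\<lambda>\<omega>. (\<omega>, z t \<omega>))) (A \<times> B)
        = emeasure M (A \<inter> (z t -` B \<inter> space M))"
      using A B AM by (subst emeasure_distr[OF pair]) (auto intro!: arg_cong[where f = "emeasure M"])
    also have "\<dots> = emeasure M A * emeasure P B"
      by (simp add: emeasure_eq_measure P.emeasure_eq_measure fresh[OF A B] ennreal_mult)
    also have "emeasure M A = emeasure ?F A"
      using A AM by (subst emeasure_distr[OF id]) (auto intro!: arg_cong[where f = "emeasure M"])
    finally show "emeasure ?F A * emeasure P B
        = emeasure (distr M (\<F> t \<Otimes>\<^sub>M P) (\<lambda>\<omega>. (\<omega>, z t \<omega>))) (A \<times> B)" ..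
  qed
  have h': "h \<in> borel_measurable (?F \<Otimes>\<^sub>M P)"
    using h by (subst measurable_cong_sets[OF sets_pair_measure_cong refl]) auto
  have "(\<integral>\<^sup>+\<omega>. h (\<omega>, z t \<omega>) \<partial>M) = (\<integral>\<^sup>+y. h y \<partial>distr M (\<F> t \<Otimes>\<^sub>M P) (\<lambda>\<omega>. (\<omega>, z t \<omega>)))"
    by (rule nn_integral_distr[OF pair, symmetric]) (use h in auto)
  also have "\<dots> = (\<integral>\<^sup>+y. h y \<partial>(?F \<Otimes>\<^sub>M P))" using joint by simp
  also have "\<dots> = (\<integral>\<^sup>+\<omega>. \<integral>\<^sup>+b. h (\<omega>, b) \<partial>P \<partial>?F)" by (rule P.nn_integral_fst[OF h', symmetric])
  also have "\<dots> = (\<integral>\<^sup>+\<omega>. \<integral>\<^sup>+b. h (\<omega>, b) \<partial>P \<partial>M)"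
    by (rule nn_integral_distr[OF id]) (use P.borel_measurable_nn_integral_fst[OF h] in auto)
  finally show ?thesis .
qed

lemma martingale_exp_moment:
  fixes S :: "nat \<Rightarrow> 'w \<Rightarrow> 'v::real_inner"
  assumes S0: "\<And>\<omega>. \<omega> \<in> space M \<Longrightarrow> S 0 \<omega> = 0"
    and SSuc: "\<And>k \<omega>. \<omega> \<in> space M \<Longrightarrow> S (Suc k) \<omega> = S k \<omega> + \<psi> k \<omega> (z k \<omega>)"
    and S_meas: "\<And>k. (\<lambda>\<omega>. norm (S k \<omega>)) \<in> borel_measurable (\<F> k)"
    and S\<psi>_meas: "\<And>k. (\<lambda>(\<omega>, b). S k \<omega> \<bullet> \<psi> k \<omega> b) \<in> borel_measurable (\<F> k \<Otimes>\<^sub>M P)"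
    and \<psi>_meas: "\<And>k. (\<lambda>(\<omega>, b). norm (\<psi> k \<omega> b)) \<in> borel_measurable (\<F> k \<Otimes>\<^sub>M P)"
    and mean: "\<And>k \<omega>. \<omega> \<in> space M \<Longrightarrow> (\<integral>b. S k \<omega> \<bullet> \<psi> k \<omega> b \<partial>P) = 0"
    and sg: "\<And>k \<omega>. \<omega> \<in> space M \<Longrightarrow> subgaussian P (\<lambda>b. norm (\<psi> k \<omega> b)) \<sigma>"
    and \<sigma>: "\<sigma> > 0" and tau: "\<tau> > 0"
  shows "(\<integral>\<^sup>+\<omega>. ennreal (exp (\<tau> * sqrt (1 / \<tau>\<^sup>2 + (norm (S n \<omega>))\<^sup>2))) \<partial>M)
    \<le> ennreal (exp (1 + 5 * \<tau>\<^sup>2 * \<sigma>\<^sup>2 * real n))"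
proof (induction n)
  case 0
  have "\<tau> * sqrt (1 / \<tau>\<^sup>2) = 1" using tau by (simp add: real_sqrt_divide)
  then have "(\<integral>\<^sup>+\<omega>. ennreal (exp (\<tau> * sqrt (1 / \<tau>\<^sup>2 + (norm (S 0 \<omega>))\<^sup>2))) \<partial>M) = (\<integral>\<^sup>+\<omega>. ennreal (exp 1) \<partial>M)"
    by (intro nn_integral_cong) (simp add: S0)
  then show ?case by (simp add: emeasure_space_1)
next
  case (Suc n)
  let ?h = "\<lambda>(\<omega>, b). ennreal (exp (\<tau> * sqrt (1 / \<tau>\<^sup>2 + ((norm (S n \<omega>))\<^sup>2 + 2 * (S n \<omega> \<bullet> \<psi> n \<omega> b) + (norm (\<psi> n \<omega> b))\<^sup>2))))"
  have h: "?h \<in> borel_measurable (\<F> n \<Otimes>\<^sub>M P)"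
    using S\<psi>_meas[of n] \<psi>_meas[of n] measurable_compose[OF measurable_fst S_meas[of n], of P]
    unfolding case_prod_beta' by measurable
  have "(\<integral>\<^sup>+\<omega>. ennreal (exp (\<tau> * sqrt (1 / \<tau>\<^sup>2 + (norm (S (Suc n) \<omega>))\<^sup>2))) \<partial>M) = (\<integral>\<^sup>+\<omega>. ?h (\<omega>, z n \<omega>) \<partial>M)"
    by (intro nn_integral_cong) (simp add: SSuc dot_norm[symmetric] power2_norm_eq_inner inner_add_left inner_add_right inner_commute algebra_simps)
  also have "\<dots> = (\<integral>\<^sup>+\<omega>. \<integral>\<^sup>+b. ?h (\<omega>, b) \<partial>P \<partial>M)" by (rule nn_integral_fresh_sample[OF h])
  also have "\<dots> \<le> (\<integral>\<^sup>+\<omega>. ennreal (exp (5 * \<tau>\<^sup>2 * \<sigma>\<^sup>2)) * ennreal (exp (\<tau> * sqrt (1 / \<tau>\<^sup>2 + (norm (S n \<omega>))\<^sup>2))) \<partial>M)"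
  proof (rule nn_integral_mono)
    fix \<omega> assume w: "\<omega> \<in> space M"
    then have w': "\<omega> \<in> space (\<F> n)" by simp
    have m1: "(\<lambda>b. norm (\<psi> n \<omega> b)) \<in> borel_measurable P" and m2: "(\<lambda>b. S n \<omega> \<bullet> \<psi> n \<omega> b) \<in> borel_measurable P"
      using measurable_Pair2[OF \<psi>_meas w'] measurable_Pair2[OF S\<psi>_meas w'] by auto
    show "(\<integral>\<^sup>+b. ?h (\<omega>, b) \<partial>P) \<le> ennreal (exp (5 * \<tau>\<^sup>2 * \<sigma>\<^sup>2)) * ennreal (exp (\<tau> * sqrt (1 / \<tau>\<^sup>2 + (norm (S n \<omega>))\<^sup>2)))"
      using exp_potential_step[OF P.prob_space_axioms m1 m2 sg[OF w] \<sigma> tau norm_ge_zero norm_ge_zero Cauchy_Schwarz_ineq2 mean[OF w]]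
      by (simp add: ennreal_mult')
  qed
  also have "\<dots> = ennreal (exp (5 * \<tau>\<^sup>2 * \<sigma>\<^sup>2)) * (\<integral>\<^sup>+\<omega>. ennreal (exp (\<tau> * sqrt (1 / \<tau>\<^sup>2 + (norm (S n \<omega>))\<^sup>2))) \<partial>M)"
    by (intro nn_integral_cmult measurable_compose[OF measurable_\<F>_M[OF S_meas[of n]],
          where g = "\<lambda>y. ennreal (exp (\<tau> * sqrt (1 / \<tau>\<^sup>2 + y\<^sup>2)))"]) measurable
  also have "\<dots> \<le> ennreal (exp (5 * \<tau>\<^sup>2 * \<sigma>\<^sup>2)) * ennreal (exp (1 + 5 * \<tau>\<^sup>2 * \<sigma>\<^sup>2 * real n))"
    by (intro mult_left_mono Suc.IH) simp
  also have "\<dots> = ennreal (exp (1 + 5 * \<tau>\<^sup>2 * \<sigma>\<^sup>2 * real (Suc n)))"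
    by (simp add: ennreal_mult'[symmetric] exp_add[symmetric] algebra_simps)
  finally show ?case .
qed

text \<open>
  Markov's inequality with \<open>\<tau> = r / (10 \<sigma>\<^sup>2 n)\<close>, the minimizer of \<open>5 \<tau>\<^sup>2 \<sigma>\<^sup>2 n - \<tau> r\<close>.
\<close>

lemma exp_moment_imp_tail:
  fixes Y :: "'w \<Rightarrow> real"
  assumes Y: "Y \<in> borel_measurable M" and n: "n > 0" and \<sigma>: "\<sigma> > 0" and r: "r > 0"
    and mom: "\<And>\<tau>. \<tau> > 0 \<Longrightarrow> (\<integral>\<^sup>+\<omega>. ennreal (exp (\<tau> * sqrt (1 / \<tau>\<^sup>2 + (Y \<omega>)\<^sup>2))) \<partial>M)
      \<le> ennreal (exp (1 + 5 * \<tau>\<^sup>2 * \<sigma>\<^sup>2 * real n))"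
  shows "prob {\<omega> \<in> space M. r \<le> Y \<omega>} \<le> exp (1 - r\<^sup>2 / (20 * \<sigma>\<^sup>2 * real n))"
proof -
  define A where "A = {\<omega> \<in> space M. r \<le> Y \<omega>}"
  have A: "A \<in> sets M" unfolding A_def using Y by measurable
  define \<tau> where "\<tau> = r / (10 * \<sigma>\<^sup>2 * real n)"
  have tau: "\<tau> > 0" using r \<sigma> n by (simp add: \<tau>_def)
  have "ennreal (exp (\<tau> * r)) * emeasure M A = (\<integral>\<^sup>+\<omega>. ennreal (exp (\<tau> * r)) * indicator A \<omega> \<partial>M)"
    using A by (simp add: nn_integral_cmult_indicator)
  also have "\<dots> \<le> (\<integral>\<^sup>+\<omega>. ennreal (exp (\<tau> * sqrt (1 / \<tau>\<^sup>2 + (Y \<omega>)\<^sup>2))) \<partial>M)"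
  proof (intro nn_integral_mono)
    fix \<omega>
    have "r \<le> sqrt (1 / \<tau>\<^sup>2 + (Y \<omega>)\<^sup>2)" if "r \<le> Y \<omega>"
    proof (rule real_le_rsqrt)
      have "r\<^sup>2 \<le> (Y \<omega>)\<^sup>2" using that r by (intro power_mono) auto
      then show "r\<^sup>2 \<le> 1 / \<tau>\<^sup>2 + (Y \<omega>)\<^sup>2" by (smt (verit) zero_le_divide_1_iff zero_le_power2)
    qed
    then show "ennreal (exp (\<tau> * r)) * indicator A \<omega> \<le> ennreal (exp (\<tau> * sqrt (1 / \<tau>\<^sup>2 + (Y \<omega>)\<^sup>2)))"
      using tau by (auto simp: A_def indicator_def intro!: ennreal_leI)
  qed
  also have "\<dots> \<le> ennreal (exp (1 + 5 * \<tau>\<^sup>2 * \<sigma>\<^sup>2 * real n))" by (rule mom[OF tau])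
  finally have "exp (\<tau> * r) * prob A \<le> exp (1 + 5 * \<tau>\<^sup>2 * \<sigma>\<^sup>2 * real n)"
    by (simp add: emeasure_eq_measure ennreal_mult'[symmetric])
  then have "prob A \<le> exp (1 + 5 * \<tau>\<^sup>2 * \<sigma>\<^sup>2 * real n) / exp (\<tau> * r)"
    by (simp add: field_simps)
  also have "\<dots> = exp (1 - r\<^sup>2 / (20 * \<sigma>\<^sup>2 * real n))"
    unfolding exp_diff[symmetric] \<tau>_def using n \<sigma>
    by (simp add: field_simps power2_eq_square)
  finally show ?thesis unfolding A_def .
qed

end

section \<open>Tail bound for the recursive estimator\<close>

text \<open>
  The vectors in the span of an orthonormal set \<open>E\<close> have this property. It gives norms and inner
  products as finite sums of real coordinates, hence their measurability, in a space that is only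
  assumed to be an inner product space; on the real line \<open>E = {1}\<close> works.
\<close>
definition expands :: "'v::real_inner set \<Rightarrow> 'v \<Rightarrow> bool" where
  "expands E u \<longleftrightarrow> u = (\<Sum>e\<in>E. (u \<bullet> e) *\<^sub>R e)"

lemma expands_inner:
  assumes "expands E u"
  shows "u \<bullet> v = (\<Sum>e\<in>E. (u \<bullet> e) * (v \<bullet> e))"
proof -
  have "u \<bullet> v = (\<Sum>e\<in>E. (u \<bullet> e) *\<^sub>R e) \<bullet> v"
    using assms by (simp add: expands_def)
  also have "\<dots> = (\<Sum>e\<in>E. (u \<bullet> e) * (v \<bullet> e))"
    by (simp add: inner_sum_left inner_commute[of v])
  finally show ?thesis .
qed

lemma expands_zero: "expands E 0"
  by (simp add: expands_def)

lemma expands_add: "expands E u \<Longrightarrow> expands E v \<Longrightarrow> expands E (u + v)"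
  unfolding expands_def by (simp add: inner_add_left scaleR_add_left sum.distrib)

lemma expands_diff: "expands E u \<Longrightarrow> expands E v \<Longrightarrow> expands E (u - v)"
  unfolding expands_def by (simp add: inner_diff_left scaleR_diff_left sum_subtractf)

lemma expands_scaleR: "expands E u \<Longrightarrow> expands E (c *\<^sub>R u)"
  unfolding expands_def by (metis (no_types, lifting) inner_scaleR_left scaleR_scaleR scaleR_sum_right sum.cong)

context fresh_sampling
begin

text \<open>
  \<open>t + 1\<close> times the error at time \<open>t\<close> is the sum of the increments \<open>\<psi> 0, \<dots>, \<psi> t\<close>, because \<open>1 - 1 / (t + 1)\<close>
  times \<open>t + 1\<close> is \<open>t\<close>. The factor \<open>k\<close> in \<open>\<psi> k\<close> is compensated by the step length, which makes the
  increments uniformly subgaussian.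
\<close>
lemma estimator_error_tail:
  fixes H :: "'v::real_normed_vector \<Rightarrow> 'b \<Rightarrow> 'c::real_inner" and h :: "'v \<Rightarrow> 'c"
    and X :: "nat \<Rightarrow> 'w \<Rightarrow> 'v"
  assumes Z: "compact Z" and XZ: "\<And>k \<omega>. \<omega> \<in> space M \<Longrightarrow> X k \<omega> \<in> Z"
    and X_meas: "\<And>k p. p \<in> Z \<Longrightarrow> (\<lambda>\<omega>. dist (X k \<omega>) p) \<in> borel_measurable (\<F> k)"
    and step: "\<And>k \<omega>. \<omega> \<in> space M \<Longrightarrow> norm (X (Suc k) \<omega> - X k \<omega>) \<le> D / (real k + 2)"
    and D: "D \<ge> 0" and L: "L \<ge> 0" and \<sigma>: "\<sigma> > 0" and E: "finite E"
    and H_exp: "\<And>p b. p \<in> Z \<Longrightarrow> b \<in> space P \<Longrightarrow> expands E (H p b)"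
    and h_exp: "\<And>p. p \<in> Z \<Longrightarrow> expands E (h p)"
    and H_meas: "\<And>p e. p \<in> Z \<Longrightarrow> e \<in> E \<Longrightarrow> (\<lambda>b. H p b \<bullet> e) \<in> borel_measurable P"
    and unbiased: "\<And>p e. p \<in> Z \<Longrightarrow> e \<in> E \<Longrightarrow> (\<integral>b. H p b \<bullet> e \<partial>P) = h p \<bullet> e"
    and Lip: "\<And>p q b. p \<in> Z \<Longrightarrow> q \<in> Z \<Longrightarrow> b \<in> space P \<Longrightarrow> norm (H p b - H q b) \<le> L * norm (p - q)"
    and noise: "\<And>p. p \<in> Z \<Longrightarrow> subgaussian P (\<lambda>b. norm (H p b - h p)) \<sigma>"
  defines "err \<equiv> \<lambda>t \<omega>. vr_estimator (\<lambda>t. 1 / (real t + 1)) H (\<lambda>i. X i \<omega>) (\<lambda>i. z i \<omega>) t - h (X t \<omega>)"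
  shows "(\<lambda>\<omega>. norm (err t \<omega>)) \<in> borel_measurable M"
    and "r > 0 \<Longrightarrow> prob {\<omega> \<in> space M. r \<le> (real t + 1) * norm (err t \<omega>)}
      \<le> exp (1 - r\<^sup>2 / (20 * (2 * L * D + \<sigma>)\<^sup>2 * (real t + 1)))"
proof -
  have norm_meas: "(\<lambda>y. norm (f y)) \<in> borel_measurable A"
    if "\<And>y. y \<in> space A \<Longrightarrow> expands E (f y)" "\<And>e. e \<in> E \<Longrightarrow> (\<lambda>y. f y \<bullet> e) \<in> borel_measurable A"
    for A :: "'x measure" and f :: "'x \<Rightarrow> 'c"
  proof -
    have "(\<lambda>y. \<Sum>e\<in>E. (f y \<bullet> e) * (f y \<bullet> e)) \<in> borel_measurable A"
      using that(2) by (intro borel_measurable_sum borel_measurable_times) auto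
    then have "(\<lambda>y. sqrt (\<Sum>e\<in>E. (f y \<bullet> e) * (f y \<bullet> e))) \<in> borel_measurable A"
      by measurable
    then show ?thesis
      by (rule measurable_cong[THEN iffD1, rotated])
        (simp add: norm_eq_sqrt_inner expands_inner[OF that(1), symmetric])
  qed
  have H_int: "integrable P (\<lambda>b. H p b \<bullet> e)" if p: "p \<in> Z" and e: "e \<in> E" for p e
  proof (rule Bochner_Integration.integrable_bound)
    have "(\<lambda>b. norm (H p b - h p)) \<in> borel_measurable P"
      using H_meas[OF p] by (intro norm_meas expands_diff H_exp h_exp p) (auto simp: inner_diff_left)
    from subgaussian_integrable[OF P.prob_space_axioms noise[OF p] this \<sigma>]
    show "integrable P (\<lambda>b. norm (H p b - h p) * norm e + \<bar>h p \<bullet> e\<bar>)" by simp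
    have "\<bar>H p b \<bullet> e\<bar> \<le> norm (H p b - h p) * norm e + \<bar>h p \<bullet> e\<bar>" for b
      using Cauchy_Schwarz_ineq2[of "H p b - h p" e] by (simp add: inner_diff_left)
    then show "AE b in P. norm (H p b \<bullet> e) \<le> norm (norm (H p b - h p) * norm e + \<bar>h p \<bullet> e\<bar>)"
      by (intro AE_I2) (smt (verit) real_norm_def)
  qed (rule H_meas[OF p e])
  \<comment> \<open>the mean inherits the Lipschitz constant: test the unbiasedness against \<open>h p - h q\<close> itself\<close>
  have H_Lip: "norm (h p - h q) \<le> L * norm (p - q)" if p: "p \<in> Z" and q: "q \<in> Z" for p q
  proof -
    define v where "v = h p - h q"
    have v: "expands E v" unfolding v_def by (intro expands_diff h_exp p q)
    have i: "integrable P (\<lambda>b. \<Sum>e\<in>E. (v \<bullet> e) * (H p b \<bullet> e - H q b \<bullet> e))"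
      using H_int p q by (intro Bochner_Integration.integrable_sum integrable_mult_right Bochner_Integration.integrable_diff) auto
    have "v \<bullet> v = (\<Sum>e\<in>E. (v \<bullet> e) * (h p \<bullet> e - h q \<bullet> e))"
      unfolding expands_inner[OF v, of v] by (simp add: v_def inner_diff_left)
    also have "\<dots> = (\<integral>b. (\<Sum>e\<in>E. (v \<bullet> e) * (H p b \<bullet> e - H q b \<bullet> e)) \<partial>P)"
      using H_int p q by (simp add: Bochner_Integration.integral_sum unbiased)
    also have "\<dots> \<le> (\<integral>b. norm v * (L * norm (p - q)) \<partial>P)"
    proof (rule integral_mono[OF i])
      fix b assume b: "b \<in> space P"
      have "(\<Sum>e\<in>E. (v \<bullet> e) * (H p b \<bullet> e - H q b \<bullet> e)) = v \<bullet> (H p b - H q b)"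
        unfolding expands_inner[OF v, of "H p b - H q b"] by (simp add: inner_diff_left)
      also have "\<dots> \<le> norm v * norm (H p b - H q b)" by (rule norm_cauchy_schwarz)
      also have "\<dots> \<le> norm v * (L * norm (p - q))" by (intro mult_left_mono Lip p q b) simp
      finally show "(\<Sum>e\<in>E. (v \<bullet> e) * (H p b \<bullet> e - H q b \<bullet> e)) \<le> norm v * (L * norm (p - q))" .
    qed simp
    finally have "norm v * norm v \<le> norm v * (L * norm (p - q))"
      by (simp add: P.prob_space power2_norm_eq_inner[symmetric] power2_eq_square)
    then show ?thesis unfolding v_def[symmetric] using L
      by (cases "v = 0") auto
  qed
  have cont_H: "continuous_on Z (\<lambda>p. H p b \<bullet> e)" if b: "b \<in> space P" for b e
  proof -
    have "L-lipschitz_on Z (\<lambda>p. H p b)"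
      using L by (intro lipschitz_onI) (auto simp: dist_norm intro: Lip b)
    from lipschitz_on_continuous_on[OF this] show ?thesis by (intro continuous_intros)
  qed
  have cont_h: "continuous_on Z (\<lambda>p. h p \<bullet> e)" for e
  proof -
    have "L-lipschitz_on Z h"
      using L by (intro lipschitz_onI) (auto simp: dist_norm intro: H_Lip)
    from lipschitz_on_continuous_on[OF this] show ?thesis by (intro continuous_intros)
  qed
  \<comment> \<open>for \<open>k = 0\<close> the index \<open>k - 1\<close> is \<open>0\<close> and the first summand vanishes\<close>
  define \<psi> where "\<psi> k \<omega> b = real k *\<^sub>R ((H (X k \<omega>) b - H (X (k - 1) \<omega>) b) - (h (X k \<omega>) - h (X (k - 1) \<omega>)))
      + (H (X k \<omega>) b - h (X k \<omega>))" for k \<omega> b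
  define S where "S n \<omega> = (\<Sum>k<n. \<psi> k \<omega> (z k \<omega>))" for n \<omega>
  have z_P: "z k \<omega> \<in> space P" if "\<omega> \<in> space M" for k \<omega>
    using measurable_space[OF adapted] that by simp
  have S_err: "S (Suc t) \<omega> = (real t + 1) *\<^sub>R err t \<omega>" if "\<omega> \<in> space M" for t \<omega>
  proof (induction t)
    case 0
    show ?case by (simp add: S_def \<psi>_def err_def)
  next
    case (Suc t)
    have t2: "real (Suc t) + 1 = real t + 2" by simp
    have c: "(real t + 2) * (1 - 1 / (real t + 2)) = real t + 1" by (simp add: field_simps)
    let ?u = "vr_estimator (\<lambda>t. 1 / (real t + 1)) H (\<lambda>i. X i \<omega>) (\<lambda>i. z i \<omega>) t"
    let ?v = "H (X (Suc t) \<omega>) (z (Suc t) \<omega>)" and ?w = "H (X t \<omega>) (z (Suc t) \<omega>)"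
    let ?y = "h (X (Suc t) \<omega>)" and ?x = "h (X t \<omega>)"
    have "S (Suc (Suc t)) \<omega> = (real t + 1) *\<^sub>R (?u - ?x)
        + ((real t + 1) *\<^sub>R ((?v - ?w) - (?y - ?x)) + (?v - ?y))"
      using Suc.IH by (simp add: S_def \<psi>_def err_def add.commute)
    also have "\<dots> = (real t + 1) *\<^sub>R ?u + (real t + 2) *\<^sub>R ?v - (real t + 1) *\<^sub>R ?w - (real t + 2) *\<^sub>R ?y"
      by (simp add: algebra_simps) (simp add: scaleR_2)
    also have "\<dots> = (real t + 2) *\<^sub>R ((1 - 1 / (real t + 2)) *\<^sub>R ?u + ?v - (1 - 1 / (real t + 2)) *\<^sub>R ?w - ?y)"
      by (simp only: scaleR_diff_right scaleR_add_right scaleR_scaleR c)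
    also have "\<dots> = (real (Suc t) + 1) *\<^sub>R err (Suc t) \<omega>"
      by (simp only: err_def vr_estimator.simps t2)
    finally show ?case .
  qed
  have \<psi>_exp: "expands E (\<psi> k \<omega> b)" if "\<omega> \<in> space M" "b \<in> space P" for k \<omega> b
    unfolding \<psi>_def using that
    by (intro expands_add expands_scaleR expands_diff H_exp h_exp XZ)
  have S_exp: "expands E (S n \<omega>)" if "\<omega> \<in> space M" for n \<omega>
    by (induction n) (auto simp: S_def expands_zero intro!: expands_add \<psi>_exp z_P that)
  have Xp_meas: "(\<lambda>\<omega>. dist (X (k - 1) \<omega>) p) \<in> borel_measurable (\<F> k)" if "p \<in> Z" for k p
    by (rule measurable_\<F>_mono[OF X_meas[OF that]]) simp
  have H_X: "(\<lambda>(\<omega>, b). H (Y \<omega>) b \<bullet> e) \<in> borel_measurable (\<F> k \<Otimes>\<^sub>M P)"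
    "(\<lambda>(\<omega>, b). h (Y \<omega>) \<bullet> e) \<in> borel_measurable (\<F> k \<Otimes>\<^sub>M P)"
    if e: "e \<in> E" and "\<And>\<omega>. \<omega> \<in> space M \<Longrightarrow> Y \<omega> \<in> Z"
      "\<And>p. p \<in> Z \<Longrightarrow> (\<lambda>\<omega>. dist (Y \<omega>) p) \<in> borel_measurable (\<F> k)" for Y k e
    using that(2,3)
    by (auto intro!: borel_measurable_random_point[OF Z] cont_H cont_h H_meas e)
  have \<psi>_meas: "(\<lambda>(\<omega>, b). \<psi> k \<omega> b \<bullet> e) \<in> borel_measurable (\<F> k \<Otimes>\<^sub>M P)" if e: "e \<in> E" for k e
  proof -
    note m = H_X[OF e XZ X_meas, of k] H_X[OF e XZ Xp_meas, of k]
    show ?thesis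
      using m unfolding \<psi>_def case_prod_beta' inner_add_left inner_diff_left inner_scaleR_left
      by (intro borel_measurable_add borel_measurable_times borel_measurable_diff borel_measurable_const)
  qed
  have S_meas: "(\<lambda>\<omega>. S n \<omega> \<bullet> e) \<in> borel_measurable (\<F> n)" if e: "e \<in> E" for n e
  proof (induction n)
    case 0
    show ?case by (simp add: S_def)
  next
    case (Suc n)
    have "(\<lambda>\<omega>. S n \<omega> \<bullet> e) \<in> borel_measurable (\<F> (Suc n))"
      by (rule measurable_\<F>_mono[OF Suc]) simp
    moreover have "(\<lambda>\<omega>. \<psi> n \<omega> (z n \<omega>) \<bullet> e) \<in> borel_measurable (\<F> (Suc n))"
      using measurable_compose[OF measurable_sample \<psi>_meas[OF e]] by simp
    ultimately show ?case by (simp add: S_def inner_add_left)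
  qed
  have S_norm: "(\<lambda>\<omega>. norm (S n \<omega>)) \<in> borel_measurable (\<F> n)" for n
    by (rule norm_meas) (auto intro: S_exp S_meas)
  have \<psi>_norm: "(\<lambda>(\<omega>, b). norm (\<psi> k \<omega> b)) \<in> borel_measurable (\<F> k \<Otimes>\<^sub>M P)" for k
    using norm_meas[of "\<F> k \<Otimes>\<^sub>M P" "\<lambda>(\<omega>, b). \<psi> k \<omega> b"] \<psi>_meas \<psi>_exp
    by (auto simp: space_pair_measure case_prod_beta')
  have S\<psi>: "(\<lambda>(\<omega>, b). S k \<omega> \<bullet> \<psi> k \<omega> b) \<in> borel_measurable (\<F> k \<Otimes>\<^sub>M P)" for k
  proof -
    have "(\<lambda>y. \<Sum>e\<in>E. (S k (fst y) \<bullet> e) * (\<psi> k (fst y) (snd y) \<bullet> e)) \<in> borel_measurable (\<F> k \<Otimes>\<^sub>M P)"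
      using \<psi>_meas[unfolded case_prod_beta'] measurable_compose[OF measurable_fst S_meas]
      by (intro borel_measurable_sum borel_measurable_times) auto
    then show ?thesis
      by (rule measurable_cong[THEN iffD1, rotated])
        (auto simp: space_pair_measure intro!: expands_inner[OF S_exp, symmetric])
  qed
  have mean: "(\<integral>b. S k \<omega> \<bullet> \<psi> k \<omega> b \<partial>P) = 0" if w: "\<omega> \<in> space M" for k \<omega>
  proof -
    have "(\<integral>b. \<psi> k \<omega> b \<bullet> e \<partial>P) = 0" "integrable P (\<lambda>b. \<psi> k \<omega> b \<bullet> e)" if e: "e \<in> E" for e
      using H_int[OF XZ[OF w] e] w e
      by (auto simp: \<psi>_def inner_add_left inner_diff_left unbiased XZ P.prob_space)
    then show ?thesis
      by (subst expands_inner[OF S_exp[OF w]]) (simp add: Bochner_Integration.integral_sum)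
  qed
  have \<psi>_bound: "norm (\<psi> k \<omega> b) \<le> 2 * L * D + norm (H (X k \<omega>) b - h (X k \<omega>))"
    if w: "\<omega> \<in> space M" and b: "b \<in> space P" for k \<omega> b
  proof -
    have "real k * norm (X k \<omega> - X (k - 1) \<omega>) \<le> D"
    proof (cases k)
      case 0
      then show ?thesis using D by simp
    next
      case (Suc j)
      have "real k * norm (X k \<omega> - X (k - 1) \<omega>) \<le> real k * (D / (real j + 2))"
        using step[OF w, of j] Suc by (intro mult_left_mono) auto
      also have "\<dots> \<le> D" using D Suc by (simp add: field_simps)
      finally show ?thesis .
    qed
    then have "L * (real k * norm (X k \<omega> - X (k - 1) \<omega>)) \<le> L * D" using L by (rule mult_left_mono)
    moreover have "norm (real k *\<^sub>R ((H (X k \<omega>) b - H (X (k - 1) \<omega>) b) - (h (X k \<omega>) - h (X (k - 1) \<omega>))))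
        \<le> real k * (L * norm (X k \<omega> - X (k - 1) \<omega>) + L * norm (X k \<omega> - X (k - 1) \<omega>))"
      unfolding norm_scaleR
      by (intro mult_mono order_trans[OF norm_triangle_ineq4] add_mono Lip H_Lip XZ w b) auto
    ultimately have "norm (real k *\<^sub>R ((H (X k \<omega>) b - H (X (k - 1) \<omega>) b) - (h (X k \<omega>) - h (X (k - 1) \<omega>))))
        \<le> 2 * L * D" by (simp add: algebra_simps)
    then show ?thesis unfolding \<psi>_def by (intro order_trans[OF norm_triangle_ineq] add_right_mono)
  qed
  have sg: "subgaussian P (\<lambda>b. norm (\<psi> k \<omega> b)) (2 * L * D + \<sigma>)" if w: "\<omega> \<in> space M" for k \<omega>
  proof (rule subgaussian_add_bounded[OF P.prob_space_axioms noise[OF XZ[OF w]] \<sigma>])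
    show "0 \<le> 2 * L * D" using L D by simp
    show "(\<lambda>b. norm (\<psi> k \<omega> b)) \<in> borel_measurable P"
      using measurable_Pair2[OF \<psi>_norm, of \<omega>] w by simp
  qed (use \<psi>_bound[OF w] in auto)
  show "(\<lambda>\<omega>. norm (err t \<omega>)) \<in> borel_measurable M"
  proof -
    have "(\<lambda>\<omega>. norm (S (Suc t) \<omega>) / (real t + 1)) \<in> borel_measurable M"
      using measurable_\<F>_M[OF S_norm[of "Suc t"]] by (intro borel_measurable_divide) auto
    then show ?thesis
      by (rule measurable_cong[THEN iffD1, rotated]) (simp add: S_err)
  qed
  show "prob {\<omega> \<in> space M. r \<le> (real t + 1) * norm (err t \<omega>)}
      \<le> exp (1 - r\<^sup>2 / (20 * (2 * L * D + \<sigma>)\<^sup>2 * (real t + 1)))" if r: "r > 0"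
  proof -
    have pos: "2 * L * D + \<sigma> > 0" using L D \<sigma> by (simp add: add_nonneg_pos)
    have "prob {\<omega> \<in> space M. r \<le> norm (S (Suc t) \<omega>)}
        \<le> exp (1 - r\<^sup>2 / (20 * (2 * L * D + \<sigma>)\<^sup>2 * real (Suc t)))"
      by (rule exp_moment_imp_tail[OF measurable_\<F>_M[OF S_norm] _ pos r
            martingale_exp_moment[OF _ _ S_norm S\<psi> \<psi>_norm mean sg pos]])
        (auto simp: S_def)
    moreover have "{\<omega> \<in> space M. r \<le> norm (S (Suc t) \<omega>)} = {\<omega> \<in> space M. r \<le> (real t + 1) * norm (err t \<omega>)}"
      by (auto simp: S_err)
    ultimately show ?thesis by (simp add: add.commute)
  qed
qed

end

section \<open>Unbiasedness and smoothness along the feasible set\<close>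

lemma C1_on_path_derivative:
  assumes C1: "C1_on S h dh" and Z: "convex Z" "Z \<subseteq> S" "x \<in> Z" "y \<in> Z" and t: "t \<in> {0..1}"
  shows "((\<lambda>t. h (x + t *\<^sub>R (y - x))) has_derivative
    (\<lambda>u. u * (dh (x + t *\<^sub>R (y - x)) \<bullet> (y - x)))) (at t within {0..1})"
proof -
  have inZ: "x + u *\<^sub>R (y - x) \<in> Z" if "u \<in> {0..1}" for u :: real
    using convexD_alt[OF Z(1,3,4), of u] that by (simp add: algebra_simps)
  have "(h has_derivative (\<lambda>v. dh (x + t *\<^sub>R (y - x)) \<bullet> v)) (at (x + t *\<^sub>R (y - x)) within S)"
    using C1 inZ[OF t] Z(2) by (auto simp: C1_on_def)
  then have "(h has_derivative (\<lambda>v. dh (x + t *\<^sub>R (y - x)) \<bullet> v))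
      (at (x + t *\<^sub>R (y - x)) within (\<lambda>u. x + u *\<^sub>R (y - x)) ` {0..1})"
    by (rule has_derivative_subset) (use inZ Z(2) in auto)
  moreover have "((\<lambda>u. x + u *\<^sub>R (y - x)) has_derivative (\<lambda>u. u *\<^sub>R (y - x))) (at t within {0..1})"
    by (auto intro!: derivative_eq_intros)
  ultimately show ?thesis
    using diff_chain_within[of "\<lambda>u. x + u *\<^sub>R (y - x)" "\<lambda>u. u *\<^sub>R (y - x)" t "{0..1}" h
        "\<lambda>v. dh (x + t *\<^sub>R (y - x)) \<bullet> v"] by (simp add: o_def)
qed

text \<open>
  A derivative within a convex set determines the inner products of the gradient with the feasible
  directions \<open>y - x\<close>. Both the unbiasedness of the sampled gradients and the tangent inequality for
  convex functions are read off from this limit.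
\<close>
lemma C1_on_directional_limit:
  assumes C1: "C1_on Z h dh" and Z: "convex Z" "x \<in> Z" "y \<in> Z"
  shows "(\<lambda>n. (h (x + (1 / (real n + 1)) *\<^sub>R (y - x)) - h x) * (real n + 1)) \<longlonglongrightarrow> dh x \<bullet> (y - x)"
proof -
  let ?f = "\<lambda>t. h (x + t *\<^sub>R (y - x))"
  have "(?f has_field_derivative (dh x \<bullet> (y - x))) (at 0 within {0..1})"
    using C1_on_path_derivative[OF C1 Z(1) order_refl Z(2,3), of 0]
    unfolding has_field_derivative_def by (auto elim!: has_derivative_eq_rhs)
  then have "((\<lambda>t. (?f t - ?f 0) / (t - 0)) \<longlongrightarrow> dh x \<bullet> (y - x)) (at 0 within {0..1})"
    unfolding has_field_derivative_iff .
  moreover have "(\<lambda>n. 1 / (real n + 1)) \<longlonglongrightarrow> 0"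
    using LIMSEQ_Suc[OF lim_1_over_n] by (simp add: add.commute)
  ultimately have "((\<lambda>t. (?f t - ?f 0) / (t - 0)) \<circ> (\<lambda>n. 1 / (real n + 1))) \<longlonglongrightarrow> dh x \<bullet> (y - x)"
    unfolding tendsto_at_iff_sequentially by auto
  then show ?thesis by (simp add: o_def)
qed

lemma C1_on_linearization_error:
  assumes C1: "C1_on S h dh" and Z: "convex Z" "Z \<subseteq> S" "x \<in> Z" "y \<in> Z"
    and Lip: "\<And>p. p \<in> Z \<Longrightarrow> norm (dh p - dh x) \<le> L * norm (p - x)" and L: "L \<ge> 0"
  shows "\<bar>h y - h x - dh x \<bullet> (y - x)\<bar> \<le> L * (norm (y - x))\<^sup>2"
proof -
  have inZ: "x + u *\<^sub>R (y - x) \<in> Z" if "u \<in> {0..1}" for u :: real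
    using convexD_alt[OF Z(1,3,4), of u] that by (simp add: algebra_simps)
  obtain t :: real where t: "t \<in> {0<..<1}"
      and eq: "h (x + 1 *\<^sub>R (y - x)) - h (x + 0 *\<^sub>R (y - x)) = (1 - 0) * (dh (x + t *\<^sub>R (y - x)) \<bullet> (y - x))"
    using mvt_simple[of 0 1 "\<lambda>t. h (x + t *\<^sub>R (y - x))" "\<lambda>t u. u * (dh (x + t *\<^sub>R (y - x)) \<bullet> (y - x))"]
      C1_on_path_derivative[OF C1 Z] by auto
  have "\<bar>h y - h x - dh x \<bullet> (y - x)\<bar> = \<bar>(dh (x + t *\<^sub>R (y - x)) - dh x) \<bullet> (y - x)\<bar>"
    using eq by (simp add: inner_diff_left)
  also have "\<dots> \<le> norm (dh (x + t *\<^sub>R (y - x)) - dh x) * norm (y - x)" by (rule Cauchy_Schwarz_ineq2)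
  also have "\<dots> \<le> (L * norm (y - x)) * norm (y - x)"
  proof (rule mult_right_mono)
    have "norm (dh (x + t *\<^sub>R (y - x)) - dh x) \<le> L * (t * norm (y - x))"
      using Lip[OF inZ, of t] t by simp
    also have "\<dots> \<le> L * norm (y - x)"
      using t L mult_right_mono[of t 1 "norm (y - x)"] by (intro mult_left_mono) auto
    finally show "norm (dh (x + t *\<^sub>R (y - x)) - dh x) \<le> L * norm (y - x)" .
  qed simp
  finally show ?thesis by (simp add: power2_eq_square mult.assoc)
qed

lemma convex_on_above_tangent:
  assumes cvx: "convex_on Z h" and C1: "C1_on Z h dh" and Z: "x \<in> Z" "y \<in> Z"
  shows "dh x \<bullet> (y - x) \<le> h y - h x"
proof (rule LIMSEQ_le_const2)
  show "(\<lambda>n. (h (x + (1 / (real n + 1)) *\<^sub>R (y - x)) - h x) * (real n + 1)) \<longlonglongrightarrow> dh x \<bullet> (y - x)"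
    by (rule C1_on_directional_limit[OF C1 convex_on_imp_convex[OF cvx] Z])
  have "(h (x + (1 / (real n + 1)) *\<^sub>R (y - x)) - h x) * (real n + 1) \<le> h y - h x" for n
  proof -
    define t where "t = 1 / (real n + 1)"
    have t: "0 < t" "t \<le> 1" "t * (real n + 1) = 1" by (auto simp: t_def)
    have "h ((1 - t) *\<^sub>R x + t *\<^sub>R y) \<le> (1 - t) * h x + t * h y"
      using t by (intro convex_onD[OF cvx _ _ Z]) auto
    then have "h (x + t *\<^sub>R (y - x)) - h x \<le> t * (h y - h x)" by (simp add: algebra_simps)
    then have "(h (x + t *\<^sub>R (y - x)) - h x) * (real n + 1) \<le> t * (h y - h x) * (real n + 1)"
      by (rule mult_right_mono) simp
    also have "\<dots> = (t * (real n + 1)) * (h y - h x)" by (simp add: algebra_simps)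
    finally show ?thesis using t(3) by (simp add: t_def)
  qed
  then show "\<exists>N. \<forall>n\<ge>N. (h (x + (1 / (real n + 1)) *\<^sub>R (y - x)) - h x) * (real n + 1) \<le> h y - h x" by blast
qed

context stochastic_function
begin

lemma sample_grad_inner_measurable: "p \<in> Z \<Longrightarrow> (\<lambda>a. dH p a \<bullet> v) \<in> borel_measurable P"
  by (rule measurable_compose[OF sample_grad_measurable])
    (auto intro!: borel_measurable_continuous_onI continuous_intros)

context
  fixes L \<sigma> :: real
  assumes Z_convex': "convex Z" and L: "L \<ge> 0" and \<sigma>: "\<sigma> > 0"
    and Lip: "\<And>p q a. p \<in> Z \<Longrightarrow> q \<in> Z \<Longrightarrow> a \<in> space P \<Longrightarrow> norm (dH p a - dH q a) \<le> L * norm (p - q)"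
    and noise: "\<And>p. p \<in> Z \<Longrightarrow> subgaussian P (\<lambda>a. norm (dH p a - dh p)) \<sigma>"
begin

lemma sample_grad_inner_integrable:
  assumes p: "p \<in> Z"
  shows "integrable P (\<lambda>a. dH p a \<bullet> v)"
proof (rule Bochner_Integration.integrable_bound)
  have "(\<lambda>a. norm (dH p a - dh p)) \<in> borel_measurable P"
    by (rule measurable_compose[OF sample_grad_measurable[OF p]])
      (auto intro!: borel_measurable_continuous_onI continuous_intros)
  from subgaussian_integrable[OF prob_space_axioms noise[OF p] this \<sigma>]
  show "integrable P (\<lambda>a. norm (dH p a - dh p) * norm v + \<bar>dh p \<bullet> v\<bar>)" by simp
  have "\<bar>dH p a \<bullet> v\<bar> \<le> norm (dH p a - dh p) * norm v + \<bar>dh p \<bullet> v\<bar>" for a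
    using Cauchy_Schwarz_ineq2[of "dH p a - dh p" v] by (simp add: inner_diff_left)
  then show "AE a in P. norm (dH p a \<bullet> v) \<le> norm (norm (dH p a - dh p) * norm v + \<bar>dh p \<bullet> v\<bar>)"
    by (intro AE_I2) (smt (verit) real_norm_def)
qed (rule sample_grad_inner_measurable[OF p])

lemma mean_linearization_error_expected_grad:
  assumes x: "x \<in> Z" and y: "y \<in> Z"
  shows "\<bar>mean_fun P H y - mean_fun P H x - (\<integral>a. dH x a \<bullet> (y - x) \<partial>P)\<bar> \<le> L * (norm (y - x))\<^sup>2"
proof -
  have "\<bar>H y a - H x a - dH x a \<bullet> (y - x)\<bar> \<le> L * (norm (y - x))\<^sup>2" if a: "a \<in> space P" for a
  proof -
    obtain U where U: "Z \<subseteq> U" "C1_on U (\<lambda>p. H p a) (\<lambda>p. dH p a)" using sample_C1[OF a] by blast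
    show ?thesis
      by (rule C1_on_linearization_error[OF U(2) Z_convex' U(1) x y Lip[OF _ x a] L])
  qed
  then have "(\<integral>a. \<bar>H y a - H x a - dH x a \<bullet> (y - x)\<bar> \<partial>P) \<le> (\<integral>a. L * (norm (y - x))\<^sup>2 \<partial>P)"
    by (intro integral_mono)
      (auto intro!: Bochner_Integration.integrable_diff sample_integrable sample_grad_inner_integrable x y)
  then have "\<bar>\<integral>a. H y a - H x a - dH x a \<bullet> (y - x) \<partial>P\<bar> \<le> (\<integral>a. L * (norm (y - x))\<^sup>2 \<partial>P)"
    by (rule order_trans[OF integral_abs_bound])
  then show ?thesis
    using sample_integrable x y sample_grad_inner_integrable[OF x]
    by (simp add: mean_fun_def prob_space)
qed

text \<open>
  The difference quotients of the mean along \<open>y - x\<close> differ from the expected sampled slope by at most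
  the step length times \<open>L \<parallel>y - x\<parallel>\<^sup>2\<close>, and they converge to the slope of the mean.
\<close>
lemma grad_unbiased_direction:
  assumes x: "x \<in> Z" and y: "y \<in> Z"
  shows "(\<integral>a. dH x a \<bullet> (y - x) \<partial>P) = dh x \<bullet> (y - x)"
proof -
  define I where "I = (\<integral>a. dH x a \<bullet> (y - x) \<partial>P)"
  let ?m = "mean_fun P H"
  let ?q = "\<lambda>n. (?m (x + (1 / (real n + 1)) *\<^sub>R (y - x)) - ?m x) * (real n + 1)"
  have "\<bar>?q n - I\<bar> \<le> L * (norm (y - x))\<^sup>2 * (1 / (real n + 1))" for n
  proof -
    define t where "t = 1 / (real n + 1)"
    have t: "0 < t" "t \<le> 1" "t * (real n + 1) = 1" by (auto simp: t_def)
    have "x + t *\<^sub>R (y - x) \<in> Z"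
      using convexD_alt[OF Z_convex' x y, of t] t by (simp add: algebra_simps)
    from mean_linearization_error_expected_grad[OF x this]
    have "\<bar>?m (x + t *\<^sub>R (y - x)) - ?m x - t * I\<bar> \<le> L * (t\<^sup>2 * (norm (y - x))\<^sup>2)"
      by (simp add: I_def power_mult_distrib)
    then have "\<bar>?m (x + t *\<^sub>R (y - x)) - ?m x - t * I\<bar> * (real n + 1) \<le> L * (t\<^sup>2 * (norm (y - x))\<^sup>2) * (real n + 1)"
      by (rule mult_right_mono) simp
    also have "L * (t\<^sup>2 * (norm (y - x))\<^sup>2) * (real n + 1) = L * (norm (y - x))\<^sup>2 * t * (t * (real n + 1))"
      by (simp add: power2_eq_square algebra_simps)
    also have "\<bar>?m (x + t *\<^sub>R (y - x)) - ?m x - t * I\<bar> * (real n + 1)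
        = \<bar>(?m (x + t *\<^sub>R (y - x)) - ?m x - t * I) * (real n + 1)\<bar>"
      by (simp add: abs_mult)
    also have "(?m (x + t *\<^sub>R (y - x)) - ?m x - t * I) * (real n + 1)
        = (?m (x + t *\<^sub>R (y - x)) - ?m x) * (real n + 1) - I * (t * (real n + 1))"
      by (simp add: algebra_simps)
    finally show ?thesis using t(3) by (simp add: t_def)
  qed
  moreover have "(\<lambda>n. L * (norm (y - x))\<^sup>2 * (1 / (real n + 1))) \<longlonglongrightarrow> L * (norm (y - x))\<^sup>2 * 0"
    using LIMSEQ_Suc[OF lim_1_over_n] by (intro tendsto_mult tendsto_const) (simp add: add.commute)
  ultimately have "(\<lambda>n. ?q n - I) \<longlonglongrightarrow> 0"
    by (intro Lim_null_comparison[of "\<lambda>n. ?q n - I" "\<lambda>n. L * (norm (y - x))\<^sup>2 * (1 / (real n + 1))"]) auto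
  then have "?q \<longlonglongrightarrow> I" by (simp add: LIM_zero_iff)
  from LIMSEQ_unique[OF this C1_on_directional_limit[OF mean_C1 Z_convex' x y]] show ?thesis
    by (simp only: I_def)
qed

lemma grad_unbiased_span:
  assumes x: "x \<in> Z" and y: "y \<in> Z" and v: "v \<in> span ((\<lambda>p. p - y) ` Z)"
  shows "(\<integral>a. dH x a \<bullet> v \<partial>P) = dh x \<bullet> v"
  using v
proof (induction rule: span_induct)
  case (step u)
  then obtain p where p: "p \<in> Z" "u = (p - x) - (y - x)" by auto
  show ?case unfolding p(2) inner_diff_right[of _ "p - x"]
    using grad_unbiased_direction[OF x p(1)] grad_unbiased_direction[OF x y]
    by (simp add: sample_grad_inner_integrable[OF x])
next
  case base
  then show ?case
    by (auto simp: subspace_def inner_add_right sample_grad_inner_integrable[OF x])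
qed

lemma mean_linearization_error:
  assumes x: "x \<in> Z" and y: "y \<in> Z"
  shows "\<bar>mean_fun P H y - mean_fun P H x - dh x \<bullet> (y - x)\<bar> \<le> L * (norm (y - x))\<^sup>2"
  using mean_linearization_error_expected_grad[OF x y] grad_unbiased_direction[OF x y] by simp

end

end

definition unit_seq :: "nat \<Rightarrow> fin_seq" where
  "unit_seq i = Abs_fin_seq (\<lambda>j. if j = i then 1 else 0)"

lemma coord_unit_seq: "coord (unit_seq i) j = (if j = i then 1 else 0)"
proof -
  have "finite {j. (if j = i then 1 else 0 :: real) \<noteq> 0}"
    by (rule finite_subset[of _ "{i}"]) auto
  then show ?thesis by (simp add: unit_seq_def Abs_fin_seq_inverse)
qed

lemma coord_sum: "coord (\<Sum>i\<in>A. f i) j = (\<Sum>i\<in>A. coord (f i) j)"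
  by (induction A rule: infinite_finite_induct) auto

lemma Rn_subset_span: "Rn d \<subseteq> span (unit_seq ` {..<d})"
proof
  fix x assume x: "x \<in> Rn d"
  have "x = (\<Sum>i<d. coord x i *\<^sub>R unit_seq i)"
    using x
    by (auto simp: coord_inject[symmetric] fun_eq_iff coord_sum coord_unit_seq Rn_def if_distrib[of "(*) _"] not_less cong: if_cong)
  also have "\<dots> \<in> span (unit_seq ` {..<d})"
    by (intro span_sum span_scale span_base) auto
  finally show "x \<in> span (unit_seq ` {..<d})" .
qed

lemma inner_unit_seq: "x \<bullet> unit_seq i = coord x i"
proof -
  have "unit_seq i \<bullet> x = (\<Sum>j\<in>{i}. coord (unit_seq i) j * coord x j)"
    by (rule inner_fin_seq_superset) (auto simp: coord_unit_seq)
  then show ?thesis by (simp add: coord_unit_seq inner_commute)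
qed

text \<open>
  In a space that may be infinite-dimensional, finiteness comes from \<open>B\<close>: a maximal independent
  subset of \<open>W\<close> is finite and can be orthonormalized.
\<close>
lemma orthonormal_basis_exists:
  fixes W B :: "'v::real_inner set"
  assumes B: "finite B" "W \<subseteq> span B"
  obtains E where "finite E" "E \<subseteq> span W" "\<And>v. v \<in> span W \<Longrightarrow> expands E v"
    "\<And>e e'. e \<in> E \<Longrightarrow> e' \<in> E \<Longrightarrow> e \<bullet> e' = (if e = e' then 1 else 0)"
proof -
  obtain I where I: "I \<subseteq> W" "independent I" "W \<subseteq> span I"
    using maximal_independent_subset[of W] by blast
  have "finite I" using independent_span_bound[OF B(1) I(2)] I(1) B(2) by auto
  then obtain C where C: "finite C" "span C = span I" "pairwise orthogonal C"
    using basis_orthogonal[of I] by auto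
  have spanC: "span C = span W"
    using C(2) span_mono[OF I(1)] span_minimal[OF I(3) subspace_span] by auto
  define E where "E = (\<lambda>c. c /\<^sub>R norm c) ` (C - {0})"
  have finE: "finite E" using C(1) by (simp add: E_def)
  have ortho: "e \<bullet> e' = (if e = e' then 1 else 0)" if e: "e \<in> E" "e' \<in> E" for e e'
  proof -
    obtain c c' where c: "c \<in> C" "c \<noteq> 0" "e = c /\<^sub>R norm c" "c' \<in> C" "c' \<noteq> 0" "e' = c' /\<^sub>R norm c'"
      using e by (auto simp: E_def)
    show ?thesis
    proof (cases "c = c'")
      case True
      then show ?thesis using c by (simp add: power2_norm_eq_inner[symmetric] power2_eq_square)
    next
      case False
      then have z: "e \<bullet> e' = 0"
        using C(3) c by (auto simp: pairwise_def orthogonal_def)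
      moreover have "e \<noteq> e'"
      proof
        assume "e = e'"
        then have "e \<bullet> e = 0" using z by simp
        then show False using c by simp
      qed
      ultimately show ?thesis by simp
    qed
  qed
  have expE: "expands E e" if e: "e \<in> E" for e
  proof -
    have "(\<Sum>e'\<in>E. (e \<bullet> e') *\<^sub>R e') = (\<Sum>e'\<in>E. if e' = e then e' else 0)"
      by (intro sum.cong) (auto simp: ortho e)
    then show ?thesis using finE e by (simp add: expands_def)
  qed
  have "expands E v" if "v \<in> span W" for v
    using that unfolding spanC[symmetric]
  proof (induction rule: span_induct)
    case (step c)
    show ?case
    proof (cases "c = 0")
      case False
      then have "expands E (norm c *\<^sub>R (c /\<^sub>R norm c))"
        using step by (intro expands_scaleR expE) (auto simp: E_def)
      then show ?thesis using False by simp
    qed (simp add: expands_zero)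
  next
    case base
    then show ?case by (auto simp: subspace_def expands_zero expands_add expands_scaleR)
  qed
  moreover have "E \<subseteq> span W"
    unfolding spanC[symmetric] E_def by (intro image_subsetI span_scale span_base) auto
  ultimately show thesis using that finE ortho by blast
qed

section \<open>Projected gradient errors\<close>

lemma vr_estimator_linear:
  assumes "linear \<pi>"
  shows "\<pi> (vr_estimator a H X z t) = vr_estimator a (\<lambda>p b. \<pi> (H p b)) X z t"
  using assms by (induction t) (simp_all add: linear_diff linear_add linear_scale)

text \<open>
  \<open>\<pi>\<close> is the orthogonal projection onto the span of the differences of points of \<open>Z\<close>. Projected
  gradients are unbiased and at most as long, inner products with differences of points of \<open>Z\<close> are
  unchanged, and the estimator commutes with \<open>\<pi>\<close> by linearity. So the bound \<open>N\<close> is the norm of the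
  projected error. No convergence in the normal directions is claimed: there the estimator need
  not be centred at \<open>dh\<close>.
\<close>
lemma (in fresh_sampling) gradient_error_tail:
  fixes X :: "nat \<Rightarrow> 'w \<Rightarrow> fin_seq"
  assumes sf: "stochastic_function P d Z H dH dh"
    and Z: "convex Z" "compact Z" "Z \<subseteq> Rn d" and XZ: "\<And>k \<omega>. \<omega> \<in> space M \<Longrightarrow> X k \<omega> \<in> Z"
    and X_meas: "\<And>k p. p \<in> Z \<Longrightarrow> (\<lambda>\<omega>. dist (X k \<omega>) p) \<in> borel_measurable (\<F> k)"
    and step: "\<And>k \<omega>. \<omega> \<in> space M \<Longrightarrow> norm (X (Suc k) \<omega> - X k \<omega>) \<le> D / (real k + 2)"
    and D: "D \<ge> 0" and L: "L \<ge> 0" and \<sigma>: "\<sigma> > 0"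
    and Lip: "\<And>p q b. p \<in> Z \<Longrightarrow> q \<in> Z \<Longrightarrow> b \<in> space P \<Longrightarrow> norm (dH p b - dH q b) \<le> L * norm (p - q)"
    and noise: "\<And>p. p \<in> Z \<Longrightarrow> subgaussian P (\<lambda>b. norm (dH p b - dh p)) \<sigma>"
  obtains N where "\<And>t. N t \<in> borel_measurable M" "\<And>t \<omega>. 0 \<le> N t \<omega>"
    "\<And>t \<omega> p q. p \<in> Z \<Longrightarrow> q \<in> Z \<Longrightarrow>
      \<bar>(vr_estimator (\<lambda>t. 1 / (real t + 1)) dH (\<lambda>i. X i \<omega>) (\<lambda>i. z i \<omega>) t - dh (X t \<omega>)) \<bullet> (p - q)\<bar>
        \<le> N t \<omega> * norm (p - q)"
    "\<And>t r. r > 0 \<Longrightarrow> prob {\<omega> \<in> space M. r \<le> (real t + 1) * N t \<omega>}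
      \<le> exp (1 - r\<^sup>2 / (20 * (2 * L * D + \<sigma>)\<^sup>2 * (real t + 1)))"
proof -
  interpret sf: stochastic_function P d Z H dH dh by (rule sf)
  obtain \<omega>0 where "\<omega>0 \<in> space M" using not_empty by blast
  then obtain y where y: "y \<in> Z" using XZ by blast
  let ?W = "(\<lambda>p. p - y) ` Z"
  have "?W \<subseteq> span (unit_seq ` {..<d})"
    using Rn_subset_span[of d] Z(3) y by (auto intro!: span_diff)
  then obtain E where E: "finite E" "E \<subseteq> span ?W" "\<And>v. v \<in> span ?W \<Longrightarrow> expands E v"
      "\<And>e e'. e \<in> E \<Longrightarrow> e' \<in> E \<Longrightarrow> e \<bullet> e' = (if e = e' then 1 else 0)"
    using orthonormal_basis_exists[of "unit_seq ` {..<d}" ?W] by blast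
  define \<pi> where "\<pi> u = (\<Sum>e\<in>E. (u \<bullet> e) *\<^sub>R e)" for u
  have lin: "linear \<pi>"
    by (rule linearI) (simp_all add: \<pi>_def inner_add_left scaleR_add_left sum.distrib scaleR_sum_right)
  have \<pi>_inner: "\<pi> u \<bullet> e = u \<bullet> e" if e: "e \<in> E" for u e
  proof -
    have "\<pi> u \<bullet> e = (\<Sum>e'\<in>E. if e' = e then u \<bullet> e' else 0)"
      unfolding \<pi>_def inner_sum_left by (intro sum.cong) (auto simp: E(4) e)
    then show ?thesis using E(1) e by simp
  qed
  have \<pi>_exp: "expands E (\<pi> u)" for u
    unfolding expands_def by (simp add: \<pi>_inner) (simp add: \<pi>_def)
  have \<pi>_span: "u \<bullet> v = \<pi> u \<bullet> v" if "v \<in> span ?W" for u v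
    using expands_inner[OF E(3)[OF that], of u] expands_inner[OF E(3)[OF that], of "\<pi> u"]
    by (simp add: \<pi>_inner inner_commute[of _ v] cong: sum.cong)
  have \<pi>_norm: "norm (\<pi> u) \<le> norm u" for u
  proof -
    have "\<pi> u \<bullet> \<pi> u = \<pi> u \<bullet> u"
      using expands_inner[OF \<pi>_exp, of u "\<pi> u"] expands_inner[OF \<pi>_exp, of u u]
      by (simp add: \<pi>_inner cong: sum.cong)
    also have "\<dots> \<le> norm (\<pi> u) * norm u" by (rule norm_cauchy_schwarz)
    finally have "norm (\<pi> u) * norm (\<pi> u) \<le> norm (\<pi> u) * norm u"
      by (simp add: power2_norm_eq_inner[symmetric] power2_eq_square)
    then show ?thesis by (cases "\<pi> u = 0") auto
  qed
  have \<pi>_diff: "\<pi> u - \<pi> v = \<pi> (u - v)" for u v by (simp add: linear_diff[OF lin])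
  define err where "err t \<omega> = vr_estimator (\<lambda>t. 1 / (real t + 1)) (\<lambda>p b. \<pi> (dH p b)) (\<lambda>i. X i \<omega>) (\<lambda>i. z i \<omega>) t - \<pi> (dh (X t \<omega>))" for t \<omega>
  have err: "err t \<omega> = \<pi> (vr_estimator (\<lambda>t. 1 / (real t + 1)) dH (\<lambda>i. X i \<omega>) (\<lambda>i. z i \<omega>) t - dh (X t \<omega>))" for t \<omega>
    by (simp add: err_def vr_estimator_linear[OF lin] linear_diff[OF lin])
  have H_meas: "(\<lambda>b. \<pi> (dH p b) \<bullet> e) \<in> borel_measurable P" if "p \<in> Z" "e \<in> E" for p e
    using sf.sample_grad_inner_measurable[OF that(1), of e] by (simp add: \<pi>_inner[OF that(2)])
  have unb: "(\<integral>b. \<pi> (dH p b) \<bullet> e \<partial>P) = \<pi> (dh p) \<bullet> e" if "p \<in> Z" "e \<in> E" for p e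
    unfolding \<pi>_inner[OF that(2)]
    by (rule sf.grad_unbiased_span[OF Z(1) L \<sigma> _ _ that(1) y]) (use Lip noise E(2) that(2) in auto)
  have Lip': "norm (\<pi> (dH p b) - \<pi> (dH q b)) \<le> L * norm (p - q)" if "p \<in> Z" "q \<in> Z" "b \<in> space P" for p q b
    unfolding \<pi>_diff by (rule order_trans[OF \<pi>_norm Lip[OF that]])
  have noise': "subgaussian P (\<lambda>b. norm (\<pi> (dH p b) - \<pi> (dh p))) \<sigma>" if p: "p \<in> Z" for p
  proof -
    have "subgaussian P (\<lambda>b. norm (\<pi> (dH p b) - \<pi> (dh p))) (0 + \<sigma>)"
    proof (rule subgaussian_add_bounded[OF P.prob_space_axioms noise[OF p] \<sigma> order_refl])
      have c: "continuous_on UNIV \<pi>"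
        unfolding \<pi>_def by (intro continuous_intros)
      show "(\<lambda>b. norm (\<pi> (dH p b) - \<pi> (dh p))) \<in> borel_measurable P"
        by (rule measurable_compose[OF sf.sample_grad_measurable[OF p]])
          (intro borel_measurable_continuous_onI continuous_intros c)
    qed (simp add: \<pi>_diff \<pi>_norm)
    then show ?thesis by simp
  qed
  have meas: "(\<lambda>\<omega>. norm (err t \<omega>)) \<in> borel_measurable M" for t
    unfolding err_def
    by (rule estimator_error_tail(1)[where E = E and Z = Z and L = L and D = D and \<sigma> = \<sigma>])
      (use Z(2) XZ X_meas step D L \<sigma> E(1) \<pi>_exp H_meas unb Lip' noise' in auto)
  have tail: "prob {\<omega> \<in> space M. r \<le> (real t + 1) * norm (err t \<omega>)}
      \<le> exp (1 - r\<^sup>2 / (20 * (2 * L * D + \<sigma>)\<^sup>2 * (real t + 1)))" if "r > 0" for t r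
    unfolding err_def
    by (rule estimator_error_tail(2)[where E = E and Z = Z])
      (use that Z(2) XZ X_meas step D L \<sigma> E(1) \<pi>_exp H_meas unb Lip' noise' in auto)
  show thesis
  proof (rule that[of "\<lambda>t \<omega>. norm (err t \<omega>)"])
    fix t \<omega> p q assume p: "p \<in> Z" and q: "q \<in> Z"
    have "p - q = (p - y) - (q - y)" by simp
    also have "\<dots> \<in> span ?W" using p q by (intro span_diff span_base) auto
    finally show "\<bar>(vr_estimator (\<lambda>t. 1 / (real t + 1)) dH (\<lambda>i. X i \<omega>) (\<lambda>i. z i \<omega>) t - dh (X t \<omega>)) \<bullet> (p - q)\<bar>
        \<le> norm (err t \<omega>) * norm (p - q)"
      unfolding err by (subst \<pi>_span) (auto intro: Cauchy_Schwarz_ineq2)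
  qed (use meas tail in auto)
qed

lemma sum_inverse_sqrt_le: "(\<Sum>k<t. 1 / sqrt (real k + 1)) \<le> 2 * sqrt (real t)"
proof (induction t)
  case (Suc t)
  have "1 / sqrt (real t + 1) \<le> 2 * (sqrt (real t + 1) - sqrt (real t))"
  proof -
    have s: "0 < sqrt (real t + 1)" "0 \<le> sqrt (real t)" "sqrt (real t) \<le> sqrt (real t + 1)" by auto
    have "1 = (sqrt (real t + 1) - sqrt (real t)) * (sqrt (real t + 1) + sqrt (real t))"
      by (simp add: algebra_simps)
    also have "\<dots> \<le> (sqrt (real t + 1) - sqrt (real t)) * (2 * sqrt (real t + 1))"
      using s by (intro mult_left_mono) auto
    finally show ?thesis using s(1) by (simp add: field_simps)
  qed
  with Suc show ?case by (simp add: add.commute)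
qed simp

lemma sum_inverse_square_le: "(\<Sum>k<t. 1 / (real (max k 1))\<^sup>2) \<le> 3"
proof -
  have "(\<Sum>k<Suc (Suc n). 1 / (real (max k 1))\<^sup>2) \<le> 3 - 1 / (real n + 1)" for n
  proof (induction n)
    case (Suc n)
    have "1 / (real n + 2)\<^sup>2 \<le> 1 / (real n + 1) - 1 / (real n + 2)"
      by (simp add: divide_simps power2_eq_square)
    then show ?case using Suc by (simp add: add.commute)
  qed simp
  note b = this
  have "(\<Sum>k<t. 1 / (real (max k 1))\<^sup>2) \<le> (\<Sum>k<Suc (Suc t). 1 / (real (max k 1))\<^sup>2)"
    by (intro sum_mono2) auto
  also have "\<dots> \<le> 3 - 1 / (real t + 1)" by (rule b)
  also have "\<dots> \<le> 3" by simp
  finally show ?thesis .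
qed

text \<open>
  \<open>(k + 1) a\<^sub>k\<close> telescopes, and \<open>1 / sqrt (k + 1)\<close> sums to at most \<open>2 sqrt t\<close>.
\<close>
lemma averaged_recursion_bound:
  fixes a :: "nat \<Rightarrow> real"
  assumes rec: "\<And>k. k < t \<Longrightarrow> (real k + 2) * a (Suc k) \<le> (real k + 1) * a k + B / sqrt (real k + 1)"
    and B: "B \<ge> 0"
  shows "a t \<le> a 0 / (real t + 1) + 2 * B / sqrt (real t + 1)"
proof -
  have "k \<le> t \<Longrightarrow> (real k + 1) * a k \<le> a 0 + (\<Sum>j<k. B / sqrt (real j + 1))" for k
  proof (induction k)
    case (Suc k)
    then show ?case using rec[of k] by (simp add: add.commute add.left_commute)
  qed simp
  from this[of t] have "(real t + 1) * a t \<le> a 0 + B * (\<Sum>j<t. 1 / sqrt (real j + 1))"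
    by (simp add: sum_distrib_left)
  also have "\<dots> \<le> a 0 + B * (2 * sqrt (real t))"
    by (intro add_left_mono mult_left_mono sum_inverse_sqrt_le B)
  also have "\<dots> \<le> a 0 + B * (2 * sqrt (real t + 1))"
    using B by (intro add_left_mono mult_left_mono) auto
  finally have "a t \<le> (a 0 + B * (2 * sqrt (real t + 1))) / (real t + 1)"
    by (simp add: field_simps)
  also have "\<dots> = a 0 / (real t + 1) + 2 * B * (sqrt (real t + 1) / (real t + 1))"
    by (simp add: add_divide_distrib)
  also have "sqrt (real t + 1) / (real t + 1) = 1 / sqrt (real t + 1)"
    by (simp add: field_simps)
  finally show ?thesis by simp
qed

section \<open>One iteration of the algorithm\<close>

lemma C1_on_imp_continuous_on: "C1_on S h dh \<Longrightarrow> continuous_on S h"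
  unfolding C1_on_def by (auto intro: has_derivative_continuous_on)

context sbcgi
begin

lemma \<F>_space: "space (\<F> t) = space M"
  using \<F>_sub[of t] by (simp add: subalgebra_def)

lemma pair_measurable: "(\<lambda>\<omega>. (\<theta> t \<omega>, \<xi> t \<omega>)) \<in> M \<rightarrow>\<^sub>M P\<theta> \<Otimes>\<^sub>M P\<xi>"
  by (intro measurable_Pair measurable_from_subalg[OF \<F>_sub \<theta>_adapted] measurable_from_subalg[OF \<F>_sub \<xi>_adapted])

lemma prob_pair_fresh:
  assumes A: "A \<in> sets (\<F> t)" and B: "B \<in> sets P\<theta>" and C: "C \<in> sets P\<xi>"
  shows "prob (A \<inter> ((\<lambda>\<omega>. (\<theta> t \<omega>, \<xi> t \<omega>)) -` (B \<times> C) \<inter> space M))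
    = prob A * (measure P\<theta> B * measure P\<xi> C)"
proof -
  let ?p = "\<lambda>\<omega>. (\<theta> t \<omega>, \<xi> t \<omega>)"
  have BC: "B \<times> C \<in> sets (P\<theta> \<Otimes>\<^sub>M P\<xi>)" using B C by auto
  have "prob (A \<inter> (?p -` (B \<times> C) \<inter> space M)) = prob A * prob (?p -` (B \<times> C) \<inter> space M)"
    using samples_fresh[of t] A BC unfolding indep_sets2_eq by blast
  also have "prob (?p -` (B \<times> C) \<inter> space M) = measure (P\<theta> \<Otimes>\<^sub>M P\<xi>) (B \<times> C)"
    by (subst samples_law[of t, symmetric]) (rule measure_distr[OF pair_measurable BC, symmetric])
  also have "\<dots> = measure P\<theta> B * measure P\<xi> C"
    using B C by (simp add: measure_def lower.emeasure_pair_measure_Times enn2real_mult)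
  finally show ?thesis .
qed

lemma fresh_\<theta>: "fresh_sampling M P\<theta> \<F> \<theta>"
proof (intro fresh_sampling.intro fresh_sampling_axioms.intro)
  fix t A B assume A: "A \<in> sets (\<F> t)" and B: "B \<in> sets P\<theta>"
  have "(\<lambda>\<omega>. (\<theta> t \<omega>, \<xi> t \<omega>)) -` (B \<times> space P\<xi>) \<inter> space M = \<theta> t -` B \<inter> space M"
    using measurable_space[OF pair_measurable[of t]] by (auto simp: space_pair_measure)
  with prob_pair_fresh[OF A B sets.top] show "prob (A \<inter> (\<theta> t -` B \<inter> space M)) = prob A * measure P\<theta> B"
    by (simp add: lower.prob_space)
qed (fact prob_space_axioms upper.prob_space_axioms filtration \<F>_sub \<theta>_adapted)+

lemma fresh_\<xi>: "fresh_sampling M P\<xi> \<F> \<xi>"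
proof (intro fresh_sampling.intro fresh_sampling_axioms.intro)
  fix t A B assume A: "A \<in> sets (\<F> t)" and B: "B \<in> sets P\<xi>"
  have "(\<lambda>\<omega>. (\<theta> t \<omega>, \<xi> t \<omega>)) -` (space P\<theta> \<times> B) \<inter> space M = \<xi> t -` B \<inter> space M"
    using measurable_space[OF pair_measurable[of t]] by (auto simp: space_pair_measure)
  with prob_pair_fresh[OF A sets.top B] show "prob (A \<inter> (\<xi> t -` B \<inter> space M)) = prob A * measure P\<xi> B"
    by (simp add: upper.prob_space)
qed (fact prob_space_axioms lower.prob_space_axioms filtration \<F>_sub \<xi>_adapted)+

lemma dist_x_measurable:
  assumes x_Z: "\<And>k \<omega>. \<omega> \<in> space M \<Longrightarrow> x k \<omega> \<in> Z" and p: "p \<in> Z"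
  shows "(\<lambda>\<omega>. dist (x k \<omega>) p) \<in> borel_measurable (\<F> k)"
proof -
  interpret fresh_sampling M P\<xi> \<F> \<xi> by (rule fresh_\<xi>)
  have coord: "(\<lambda>\<omega>. coord (x k \<omega>) i) \<in> borel_measurable (\<F> k)" for i k
  proof (induction k)
    case 0
    have "(\<lambda>\<omega>. coord x0 i) \<in> borel_measurable (\<F> 0)" by simp
    then show ?case by (rule measurable_cong[THEN iffD1, rotated]) (simp add: x_0)
  next
    case (Suc k)
    have "(\<lambda>\<omega>. s k \<omega> \<bullet> unit_seq i) \<in> borel_measurable (\<F> (Suc k))"
      by (rule measurable_compose[OF s_adapted]) (intro borel_measurable_continuous_onI continuous_intros)
    moreover have "(\<lambda>\<omega>. coord (x k \<omega>) i) \<in> borel_measurable (\<F> (Suc k))"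
      by (rule measurable_\<F>_mono[OF Suc]) simp
    ultimately have "(\<lambda>\<omega>. (1 - \<gamma> (Suc k)) * coord (x k \<omega>) i + \<gamma> (Suc k) * (s k \<omega> \<bullet> unit_seq i)) \<in> borel_measurable (\<F> (Suc k))"
      by measurable
    then show ?case by (rule measurable_cong[THEN iffD1, rotated]) (simp add: x_Suc inner_unit_seq)
  qed
  have "(\<lambda>\<omega>. sqrt (\<Sum>i<d. (coord (x k \<omega>) i - coord p i) * (coord (x k \<omega>) i - coord p i))) \<in> borel_measurable (\<F> k)"
    using coord by measurable
  then show ?thesis
  proof (rule measurable_cong[THEN iffD1, rotated])
    fix \<omega> assume "\<omega> \<in> space (\<F> k)"
    then have "x k \<omega> \<in> Rn d" "p \<in> Rn d" using x_Z[of \<omega> k] p Z_Rn by (auto simp: \<F>_space)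
    then have "x k \<omega> - p \<in> Rn d" by (simp add: Rn_def)
    from inner_Rn[OF this, of "x k \<omega> - p"]
    show "sqrt (\<Sum>i<d. (coord (x k \<omega>) i - coord p i) * (coord (x k \<omega>) i - coord p i)) = dist (x k \<omega>) p"
      by (simp add: dist_norm norm_eq_sqrt_inner)
  qed
qed

lemma D_nonneg: "0 \<le> D"
  using Z_diameter[OF x0_Z x0_Z] by simp

lemma lower_solution_iff:
  "z \<in> lower_solutions (mean_fun P\<xi> G) Z \<longleftrightarrow> z \<in> Z \<and> (\<forall>y\<in>Z. mean_fun P\<xi> G z \<le> mean_fun P\<xi> G y)"
  by (auto simp: lower_solutions_def is_arg_min_linorder)

lemma lower_solutions_nonempty: "lower_solutions (mean_fun P\<xi> G) Z \<noteq> {}"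
proof -
  obtain z where "z \<in> Z" "\<forall>y\<in>Z. mean_fun P\<xi> G z \<le> mean_fun P\<xi> G y"
    using continuous_attains_inf[OF Z_compact _ C1_on_imp_continuous_on[OF lower.mean_C1]] x0_Z by blast
  then show ?thesis using lower_solution_iff by blast
qed

context
  assumes harmonic: "\<And>t. \<alpha> t = 1 / (real t + 1)" "\<And>t. \<beta> t = 1 / (real t + 1)"
      "\<And>t. \<rho> t = 1 / (real t + 1)" "\<And>t. \<gamma> t = 1 / (real t + 1)"
    and f_convex: "convex_on Z (mean_fun P\<theta> F)"
begin

lemma x_Z: "\<omega> \<in> space M \<Longrightarrow> x k \<omega> \<in> Z"
proof (induction k)
  case 0
  then show ?case by (simp add: x_0 x0_Z)
next
  case (Suc k)
  then show ?case
    using convexD_alt[OF Z_convex, of "x k \<omega>" "s k \<omega>" "\<gamma> (Suc k)"] s_Z[of \<omega> k]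
    by (simp add: x_Suc harmonic)
qed

lemma x_step: "\<omega> \<in> space M \<Longrightarrow> x (Suc k) \<omega> - x k \<omega> = (1 / (real k + 2)) *\<^sub>R (s k \<omega> - x k \<omega>)"
  by (simp add: x_Suc harmonic algebra_simps)

lemma x_step_norm: "\<omega> \<in> space M \<Longrightarrow> norm (x (Suc k) \<omega> - x k \<omega>) \<le> D / (real k + 2)"
  using Z_diameter[OF s_Z[of \<omega> k] x_Z[of \<omega> k]] by (simp add: x_step divide_right_mono)

lemma mean_fun_x_measurable:
  assumes "continuous_on Z h"
  shows "(\<lambda>\<omega>. h (x t \<omega>) :: real) \<in> borel_measurable M"
proof -
  have "(\<lambda>(\<omega>, \<omega>'). h (x t \<omega>)) \<in> borel_measurable (\<F> t \<Otimes>\<^sub>M \<F> t)"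
    by (rule borel_measurable_random_point[OF Z_compact])
      (auto simp: \<F>_space intro: x_Z dist_x_measurable assms)
  moreover have "(\<lambda>\<omega>. (\<omega>, \<omega>)) \<in> \<F> t \<rightarrow>\<^sub>M \<F> t \<Otimes>\<^sub>M \<F> t"
    by (intro measurable_Pair measurable_ident_sets refl)
  ultimately have "(\<lambda>\<omega>. h (x t \<omega>)) \<in> borel_measurable (\<F> t)"
    by (auto dest: measurable_compose[rotated])
  then show ?thesis by (rule measurable_from_subalg[OF \<F>_sub])
qed

text \<open>
  If \<open>K k\<close> dominates the errors, then convexity of \<open>g\<close> makes the lower-level solution \<open>z\<close> feasible,
  so that the subproblem is solved and \<open>s k\<close> competes with \<open>z\<close>: feasibility of \<open>s k\<close> bounds the slope
  of \<open>g\<close> towards \<open>s k\<close>, and optimality of \<open>s k\<close> together with convexity of \<open>f\<close> bounds the slope of \<open>f\<close>.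
  Using the estimates in place of the gradients costs \<open>D\<close> times their error each time.
\<close>
lemma one_step:
  assumes w: "\<omega> \<in> space M"
    and Nf: "\<And>p q. p \<in> Z \<Longrightarrow> q \<in> Z \<Longrightarrow>
      \<bar>(vr_estimator \<alpha> dF (\<lambda>i. x i \<omega>) (\<lambda>i. \<theta> i \<omega>) k - df (x k \<omega>)) \<bullet> (p - q)\<bar> \<le> Nf * norm (p - q)"
    and Ng: "\<And>p q. p \<in> Z \<Longrightarrow> q \<in> Z \<Longrightarrow>
      \<bar>(vr_estimator \<beta> dG (\<lambda>i. x i \<omega>) (\<lambda>i. \<xi> i \<omega>) k - dg (x k \<omega>)) \<bullet> (p - q)\<bar> \<le> Ng * norm (p - q)"
    and Nl: "\<bar>vr_estimator \<rho> G (\<lambda>i. x i \<omega>) (\<lambda>i. \<xi> i \<omega>) k - mean_fun P\<xi> G (x k \<omega>)\<bar> \<le> Nl"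
    and N0: "0 \<le> Nf" "0 \<le> Ng" and K: "Nl + D * Ng \<le> K k"
    and z: "z \<in> lower_solutions (mean_fun P\<xi> G) Z"
  shows "(real k + 2) * (mean_fun P\<xi> G (x (Suc k) \<omega>) - mean_fun P\<xi> G x0)
      \<le> (real k + 1) * (mean_fun P\<xi> G (x k \<omega>) - mean_fun P\<xi> G x0) + (2 * K k + Lg * D\<^sup>2 / (real k + 2))"
    and "(real k + 2) * (mean_fun P\<theta> F (x (Suc k) \<omega>) - mean_fun P\<theta> F z)
      \<le> (real k + 1) * (mean_fun P\<theta> F (x k \<omega>) - mean_fun P\<theta> F z) + (D * Nf + Lf * D\<^sup>2 / (real k + 2))"
proof -
  let ?f = "mean_fun P\<theta> F" and ?g = "mean_fun P\<xi> G"
  let ?gf = "vr_estimator \<alpha> dF (\<lambda>i. x i \<omega>) (\<lambda>i. \<theta> i \<omega>) k"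
  let ?gg = "vr_estimator \<beta> dG (\<lambda>i. x i \<omega>) (\<lambda>i. \<xi> i \<omega>) k"
  let ?v = "vr_estimator \<rho> G (\<lambda>i. x i \<omega>) (\<lambda>i. \<xi> i \<omega>) k"
  let ?X = "x k \<omega>" and ?S = "s k \<omega>"
  let ?feas = "{p \<in> Z. ?gg \<bullet> (p - ?X) \<le> ?g x0 - ?v + K k}"
  have X: "?X \<in> Z" and X': "x (Suc k) \<omega> \<in> Z" and S: "?S \<in> Z" using w x_Z s_Z by auto
  have zZ: "z \<in> Z" and zmin: "?g z \<le> ?g x0" using z x0_Z by (auto simp: lower_solution_iff)
  have Ngb: "\<bar>?gg \<bullet> (p - ?X) - dg ?X \<bullet> (p - ?X)\<bar> \<le> D * Ng" if p: "p \<in> Z" for p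
    using Ng[OF p X] mult_left_mono[OF Z_diameter[OF p X] N0(2)] by (simp add: inner_diff_left mult.commute)
  have feas_z: "z \<in> ?feas"
    using convex_on_above_tangent[OF g_convex lower.mean_C1 X zZ] Ngb[OF zZ] Nl K zmin zZ
    by (simp add: abs_le_iff)
  then have am: "is_arg_min (\<lambda>p. ?gf \<bullet> p) (\<lambda>p. p \<in> ?feas) ?S"
    using s_argmin[OF w, of k] by (auto simp: Let_def)
  then have feas_S: "?gg \<bullet> (?S - ?X) \<le> ?g x0 - ?v + K k" and min_S: "?gf \<bullet> ?S \<le> ?gf \<bullet> z"
    using feas_z by (auto simp: is_arg_min_linorder)
  \<comment> \<open>the common Frank-Wolfe step: \<open>h\<close> stands for \<open>f\<close> or \<open>g\<close>, \<open>c\<close> for the level that is compared with\<close>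
  have descent: "(real k + 2) * (h (x (Suc k) \<omega>) - c) \<le> (real k + 1) * (h ?X - c) + (e + L * D\<^sup>2 / (real k + 2))"
    if lin: "\<bar>h (x (Suc k) \<omega>) - h ?X - dh \<bullet> (x (Suc k) \<omega> - ?X)\<bar> \<le> L * (norm (x (Suc k) \<omega> - ?X))\<^sup>2"
      and dir: "dh \<bullet> (?S - ?X) \<le> c - h ?X + e" and L: "L \<ge> 0" for h dh c e L
  proof -
    define m where "m = real k + 2"
    have m: "m > 0" by (simp add: m_def)
    have eq: "dh \<bullet> (x (Suc k) \<omega> - ?X) = dh \<bullet> (?S - ?X) / m" by (simp add: x_step[OF w] m_def)
    have "h (x (Suc k) \<omega>) \<le> h ?X + dh \<bullet> (?S - ?X) / m + L * (norm (x (Suc k) \<omega> - ?X))\<^sup>2"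
      using lin eq by linarith
    also have "\<dots> \<le> h ?X + (c - h ?X + e) / m + L * (D / m)\<^sup>2"
      using dir L m x_step_norm[OF w, of k, folded m_def]
      by (intro add_mono order_refl divide_right_mono mult_left_mono power_mono) auto
    finally have "m * h (x (Suc k) \<omega>) \<le> m * (h ?X + (c - h ?X + e) / m + L * (D / m)\<^sup>2)"
      using m by (intro mult_left_mono) auto
    also have "\<dots> = m * h ?X + (c - h ?X + e) + L * D\<^sup>2 / m"
      using m by (simp add: field_simps power2_eq_square)
    finally show ?thesis unfolding m_def by (simp add: algebra_simps)
  qed
  show "(real k + 2) * (?g (x (Suc k) \<omega>) - ?g x0)
      \<le> (real k + 1) * (?g ?X - ?g x0) + (2 * K k + Lg * D\<^sup>2 / (real k + 2))"
  proof (rule descent[OF lower.mean_linearization_error[OF Z_convex Lg_nonneg \<sigma>g_pos _ _ X X'] _ Lg_nonneg])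
    show "dg ?X \<bullet> (?S - ?X) \<le> ?g x0 - ?g ?X + 2 * K k"
      using feas_S Ngb[OF S] Nl K by (simp add: abs_le_iff)
  qed (use G_smooth G_grad_noise in auto)
  show "(real k + 2) * (?f (x (Suc k) \<omega>) - ?f z)
      \<le> (real k + 1) * (?f ?X - ?f z) + (D * Nf + Lf * D\<^sup>2 / (real k + 2))"
  proof (rule descent[OF upper.mean_linearization_error[OF Z_convex Lf_nonneg \<sigma>f_pos _ _ X X'] _ Lf_nonneg])
    have "\<bar>?gf \<bullet> (?S - z) - df ?X \<bullet> (?S - z)\<bar> \<le> D * Nf"
      using Nf[OF S zZ] mult_left_mono[OF Z_diameter[OF S zZ] N0(1)] by (simp add: inner_diff_left mult.commute)
    moreover have "df ?X \<bullet> (z - ?X) \<le> ?f z - ?f ?X"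
      by (rule convex_on_above_tangent[OF f_convex upper.mean_C1 X zZ])
    ultimately show "df ?X \<bullet> (?S - ?X) \<le> ?f z - ?f ?X + D * Nf"
      using min_S by (simp add: inner_diff_right abs_le_iff)
  qed (use F_smooth F_grad_noise in auto)
qed

text \<open>
  The three estimators share one format: the gradients through projected errors, the value of \<open>g\<close> as
  an estimator on the real line.
\<close>
lemma estimator_error_bounds:
  obtains Nf Ng Nl where
    "\<And>k. Nf k \<in> borel_measurable M" "\<And>k. Ng k \<in> borel_measurable M" "\<And>k. Nl k \<in> borel_measurable M"
    "\<And>k \<omega>. 0 \<le> Nf k \<omega>" "\<And>k \<omega>. 0 \<le> Ng k \<omega>"
    "\<And>k \<omega> p q. p \<in> Z \<Longrightarrow> q \<in> Z \<Longrightarrow>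
      \<bar>(vr_estimator \<alpha> dF (\<lambda>i. x i \<omega>) (\<lambda>i. \<theta> i \<omega>) k - df (x k \<omega>)) \<bullet> (p - q)\<bar> \<le> Nf k \<omega> * norm (p - q)"
    "\<And>k \<omega> p q. p \<in> Z \<Longrightarrow> q \<in> Z \<Longrightarrow>
      \<bar>(vr_estimator \<beta> dG (\<lambda>i. x i \<omega>) (\<lambda>i. \<xi> i \<omega>) k - dg (x k \<omega>)) \<bullet> (p - q)\<bar> \<le> Ng k \<omega> * norm (p - q)"
    "\<And>k \<omega>. \<bar>vr_estimator \<rho> G (\<lambda>i. x i \<omega>) (\<lambda>i. \<xi> i \<omega>) k - mean_fun P\<xi> G (x k \<omega>)\<bar> \<le> Nl k \<omega>"
    "\<And>k r. r > 0 \<Longrightarrow> prob {\<omega> \<in> space M. r \<le> (real k + 1) * Nf k \<omega>}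
      \<le> exp (1 - r\<^sup>2 / (20 * (2 * Lf * D + \<sigma>f)\<^sup>2 * (real k + 1)))"
    "\<And>k r. r > 0 \<Longrightarrow> prob {\<omega> \<in> space M. r \<le> (real k + 1) * Ng k \<omega>}
      \<le> exp (1 - r\<^sup>2 / (20 * (2 * Lg * D + \<sigma>g)\<^sup>2 * (real k + 1)))"
    "\<And>k r. r > 0 \<Longrightarrow> prob {\<omega> \<in> space M. r \<le> (real k + 1) * Nl k \<omega>}
      \<le> exp (1 - r\<^sup>2 / (20 * (2 * Ll * D + \<sigma>l)\<^sup>2 * (real k + 1)))"
proof -
  have h: "\<alpha> = (\<lambda>t. 1 / (real t + 1))" "\<beta> = (\<lambda>t. 1 / (real t + 1))" "\<rho> = (\<lambda>t. 1 / (real t + 1))"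
    using harmonic by auto
  interpret T: fresh_sampling M P\<theta> \<F> \<theta> by (rule fresh_\<theta>)
  interpret X: fresh_sampling M P\<xi> \<F> \<xi> by (rule fresh_\<xi>)
  have dist_meas: "(\<lambda>\<omega>. dist (x k \<omega>) p) \<in> borel_measurable (\<F> k)" if "p \<in> Z" for p k
    by (rule dist_x_measurable[OF x_Z that])
  obtain Nf where Nf: "\<And>t. Nf t \<in> borel_measurable M" "\<And>t \<omega>. 0 \<le> Nf t \<omega>"
    "\<And>t \<omega> p q. p \<in> Z \<Longrightarrow> q \<in> Z \<Longrightarrow>
      \<bar>(vr_estimator \<alpha> dF (\<lambda>i. x i \<omega>) (\<lambda>i. \<theta> i \<omega>) t - df (x t \<omega>)) \<bullet> (p - q)\<bar> \<le> Nf t \<omega> * norm (p - q)"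
    "\<And>t r. r > 0 \<Longrightarrow> prob {\<omega> \<in> space M. r \<le> (real t + 1) * Nf t \<omega>}
      \<le> exp (1 - r\<^sup>2 / (20 * (2 * Lf * D + \<sigma>f)\<^sup>2 * (real t + 1)))"
    unfolding h
    by (rule T.gradient_error_tail[OF upper.stochastic_function_axioms Z_convex Z_compact Z_Rn x_Z dist_meas
          x_step_norm D_nonneg Lf_nonneg \<sigma>f_pos F_smooth F_grad_noise]) blast+
  obtain Ng where Ng: "\<And>t. Ng t \<in> borel_measurable M" "\<And>t \<omega>. 0 \<le> Ng t \<omega>"
    "\<And>t \<omega> p q. p \<in> Z \<Longrightarrow> q \<in> Z \<Longrightarrow>
      \<bar>(vr_estimator \<beta> dG (\<lambda>i. x i \<omega>) (\<lambda>i. \<xi> i \<omega>) t - dg (x t \<omega>)) \<bullet> (p - q)\<bar> \<le> Ng t \<omega> * norm (p - q)"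
    "\<And>t r. r > 0 \<Longrightarrow> prob {\<omega> \<in> space M. r \<le> (real t + 1) * Ng t \<omega>}
      \<le> exp (1 - r\<^sup>2 / (20 * (2 * Lg * D + \<sigma>g)\<^sup>2 * (real t + 1)))"
    unfolding h
    by (rule X.gradient_error_tail[OF lower.stochastic_function_axioms Z_convex Z_compact Z_Rn x_Z dist_meas
          x_step_norm D_nonneg Lg_nonneg \<sigma>g_pos G_smooth G_grad_noise]) blast+
  define Nl where "Nl t \<omega> = norm (vr_estimator (\<lambda>t. 1 / (real t + 1)) G (\<lambda>i. x i \<omega>) (\<lambda>i. \<xi> i \<omega>) t - mean_fun P\<xi> G (x t \<omega>))" for t \<omega>
  have e1: "expands {1} (u :: real)" for u by (simp add: expands_def)
  have Nl_meas: "Nl t \<in> borel_measurable M" for t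
    unfolding Nl_def
    by (rule X.estimator_error_tail(1)[where E = "{1}" and Z = Z and L = Ll and D = D and \<sigma> = \<sigma>l])
      (use Z_compact x_Z dist_meas x_step_norm D_nonneg Ll_nonneg \<sigma>l_pos e1 lower.sample_integrable
        G_Lipschitz G_noise in \<open>auto simp: mean_fun_def\<close>)
  have Nl_tail: "prob {\<omega> \<in> space M. r \<le> (real t + 1) * Nl t \<omega>}
      \<le> exp (1 - r\<^sup>2 / (20 * (2 * Ll * D + \<sigma>l)\<^sup>2 * (real t + 1)))" if "r > 0" for t r
    unfolding Nl_def
    by (rule X.estimator_error_tail(2)[where E = "{1}" and Z = Z])
      (use that Z_compact x_Z dist_meas x_step_norm D_nonneg Ll_nonneg \<sigma>l_pos e1 lower.sample_integrable
        G_Lipschitz G_noise in \<open>auto simp: mean_fun_def\<close>)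
  show thesis
    by (rule that[OF Nf(1) Ng(1) Nl_meas Nf(2) Ng(2) Nf(3) Ng(3) _ Nf(4) Ng(4) Nl_tail])
      (auto simp: Nl_def h)
qed

end

end

section \<open>Rates with high probability\<close>

context sbcgi
begin

text \<open>
  At time \<open>k\<close> the errors are compared with \<open>5 A sqrt (2 \<Lambda> k / (k + 1))\<close>, where \<open>A\<close> is the subgaussian
  parameter of the estimator. The factor \<open>5\<close> turns the tail exponent into \<open>5/2 \<Lambda> k \<ge> 2 \<Lambda> k\<close>, so a
  failure at time \<open>k\<close> has probability of order \<open>(\<delta> / k)\<^sup>2\<close> and all failures before \<open>t\<close> together have
  probability at most \<open>\<delta>\<close>. As \<open>\<zeta> \<ge> 1\<close>, the smoothness error \<open>L D\<^sup>2 / (k + 2)\<close> of a step is at most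
  \<open>L D\<^sup>2 \<zeta> / sqrt (k + 1)\<close> and joins the statistical errors in one recursion.
\<close>
lemma high_probability_bounds:
  fixes \<delta> :: real
  assumes harmonic: "\<And>t. \<alpha> t = 1 / (real t + 1)" "\<And>t. \<beta> t = 1 / (real t + 1)"
      "\<And>t. \<rho> t = 1 / (real t + 1)" "\<And>t. \<gamma> t = 1 / (real t + 1)"
    and f_convex: "convex_on Z (mean_fun P\<theta> F)"
    and \<delta>: "0 < \<delta>" "\<delta> < 1" and t: "t \<ge> 1"
    and K: "\<And>t. K t = 5 * ((2 * Ll * D + 3 / 2 * \<sigma>l) * sqrt (2 * ln (6 * real (max t 1) / \<delta>))
               + D * (2 * Lg * D + 3 / 2 * \<sigma>g) * sqrt (2 * ln (6 * real (max t 1) * real d / \<delta>)))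
             * (real t + 1) powr (- 1 / 2)"
  defines "f \<equiv> mean_fun P\<theta> F" and "g \<equiv> mean_fun P\<xi> G"
    and "\<zeta> \<equiv> sqrt (ln (6 * real t * real d / \<delta>))"
  shows "prob {\<omega> \<in> space M.
      g (x t \<omega>) - lower_value g Z
        \<le> 2 * (10 * sqrt 2 * (2 * Ll * D + 3 / 2 * \<sigma>l + D * (2 * Lg * D + 3 / 2 * \<sigma>g)) + Lg * D\<^sup>2) * \<zeta> / sqrt (real t + 1)
          + Lg * D\<^sup>2 * ln (real t) / (real t + 1) + \<epsilon>g / 2 \<and>
      f (x t \<omega>) - upper_value f g Z
        \<le> 2 * (5 * sqrt 2 * D * (2 * Lf * D + \<sigma>f) + Lf * D\<^sup>2) * \<zeta> / sqrt (real t + 1)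
          + (f x0 - upper_value f g Z + Lf * D\<^sup>2 * ln (real t)) / (real t + 1)} \<ge> 1 - \<delta>" (is "prob ?good \<ge> _")
proof -
  obtain Nf Ng Nl where
    N_meas: "\<And>k. Nf k \<in> borel_measurable M" "\<And>k. Ng k \<in> borel_measurable M" "\<And>k. Nl k \<in> borel_measurable M"
    and N0: "\<And>k \<omega>. 0 \<le> Nf k \<omega>" "\<And>k \<omega>. 0 \<le> Ng k \<omega>"
    and Nf: "\<And>k \<omega> p q. p \<in> Z \<Longrightarrow> q \<in> Z \<Longrightarrow>
      \<bar>(vr_estimator \<alpha> dF (\<lambda>i. x i \<omega>) (\<lambda>i. \<theta> i \<omega>) k - df (x k \<omega>)) \<bullet> (p - q)\<bar> \<le> Nf k \<omega> * norm (p - q)"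
    and Ng: "\<And>k \<omega> p q. p \<in> Z \<Longrightarrow> q \<in> Z \<Longrightarrow>
      \<bar>(vr_estimator \<beta> dG (\<lambda>i. x i \<omega>) (\<lambda>i. \<xi> i \<omega>) k - dg (x k \<omega>)) \<bullet> (p - q)\<bar> \<le> Ng k \<omega> * norm (p - q)"
    and Nl: "\<And>k \<omega>. \<bar>vr_estimator \<rho> G (\<lambda>i. x i \<omega>) (\<lambda>i. \<xi> i \<omega>) k - mean_fun P\<xi> G (x k \<omega>)\<bar> \<le> Nl k \<omega>"
    and tails: "\<And>k r. r > 0 \<Longrightarrow> prob {\<omega> \<in> space M. r \<le> (real k + 1) * Nf k \<omega>}
      \<le> exp (1 - r\<^sup>2 / (20 * (2 * Lf * D + \<sigma>f)\<^sup>2 * (real k + 1)))"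
    "\<And>k r. r > 0 \<Longrightarrow> prob {\<omega> \<in> space M. r \<le> (real k + 1) * Ng k \<omega>}
      \<le> exp (1 - r\<^sup>2 / (20 * (2 * Lg * D + \<sigma>g)\<^sup>2 * (real k + 1)))"
    "\<And>k r. r > 0 \<Longrightarrow> prob {\<omega> \<in> space M. r \<le> (real k + 1) * Nl k \<omega>}
      \<le> exp (1 - r\<^sup>2 / (20 * (2 * Ll * D + \<sigma>l)\<^sup>2 * (real k + 1)))"
    by (rule estimator_error_bounds[OF harmonic f_convex]) (rule that)
  define \<Lambda> where "\<Lambda> k = ln (6 * real (max k 1) / \<delta>)" for k
  have arg: "6 * real (max k 1) / \<delta> \<ge> 6" for k
  proof -
    have "1 \<le> real (max k 1)" by simp
    then have "6 * \<delta> \<le> 6 * real (max k 1)" using \<delta> by linarith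
    then show ?thesis using \<delta> by (simp only: pos_le_divide_eq)
  qed
  have \<Lambda>pos: "\<Lambda> k > 0" for k using arg[of k] by (simp add: \<Lambda>_def)
  have exp_\<Lambda>: "exp (1 - 2 * \<Lambda> k) \<le> \<delta>\<^sup>2 / 12 * (1 / (real (max k 1))\<^sup>2)" for k
  proof -
    have "exp (\<Lambda> k) = 6 * real (max k 1) / \<delta>" using arg[of k] by (simp add: \<Lambda>_def)
    then have "exp (1 - 2 * \<Lambda> k) = exp 1 * (\<delta> / (6 * real (max k 1)))\<^sup>2"
      by (simp add: exp_diff exp_double power_divide)
    also have "\<dots> \<le> 3 * (\<delta> / (6 * real (max k 1)))\<^sup>2" by (intro mult_right_mono exp_le) simp
    finally show ?thesis by (simp add: power_divide power_mult_distrib)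
  qed
  define r where "r A k = 5 * A * sqrt (2 * \<Lambda> k) * sqrt (real k + 1)" for A k
  have tail_at: "prob {\<omega> \<in> space M. r A k \<le> (real k + 1) * N k \<omega>} \<le> \<delta>\<^sup>2 / 12 * (1 / (real (max k 1))\<^sup>2)"
    if A: "A > 0" and tail: "\<And>k r. r > 0 \<Longrightarrow> prob {\<omega> \<in> space M. r \<le> (real k + 1) * N k \<omega>}
      \<le> exp (1 - r\<^sup>2 / (20 * A\<^sup>2 * (real k + 1)))" for A N k
  proof -
    have "r A k > 0" using A \<Lambda>pos[of k] by (simp add: r_def)
    from tail[OF this] have "prob {\<omega> \<in> space M. r A k \<le> (real k + 1) * N k \<omega>}
        \<le> exp (1 - (r A k)\<^sup>2 / (20 * A\<^sup>2 * (real k + 1)))" .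
    also have "(r A k)\<^sup>2 / (20 * A\<^sup>2 * (real k + 1)) = 5 / 2 * \<Lambda> k"
      using A \<Lambda>pos[of k] by (simp add: r_def power_mult_distrib)
    also have "exp (1 - 5 / 2 * \<Lambda> k) \<le> exp (1 - 2 * \<Lambda> k)" using \<Lambda>pos[of k] by simp
    also note exp_\<Lambda>
    finally show ?thesis .
  qed
  define Af Ag Al where "Af = 2 * Lf * D + \<sigma>f" and "Ag = 2 * Lg * D + \<sigma>g" and "Al = 2 * Ll * D + \<sigma>l"
  have Apos: "Af > 0" "Ag > 0" "Al > 0"
    using D_nonneg Lf_nonneg Lg_nonneg Ll_nonneg \<sigma>f_pos \<sigma>g_pos \<sigma>l_pos
    by (auto simp: Af_def Ag_def Al_def intro: add_nonneg_pos)
  define bf bg bl where "bf k = {\<omega> \<in> space M. r Af k \<le> (real k + 1) * Nf k \<omega>}"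
    and "bg k = {\<omega> \<in> space M. r Ag k \<le> (real k + 1) * Ng k \<omega>}"
    and "bl k = {\<omega> \<in> space M. r Al k \<le> (real k + 1) * Nl k \<omega>}" for k
  have b_sets: "bf k \<in> sets M" "bg k \<in> sets M" "bl k \<in> sets M" for k
    using N_meas[of k] by (auto simp: bf_def bg_def bl_def)
  have b_prob: "prob (bf k) \<le> \<delta>\<^sup>2 / 12 * (1 / (real (max k 1))\<^sup>2)" "prob (bg k) \<le> \<delta>\<^sup>2 / 12 * (1 / (real (max k 1))\<^sup>2)"
      "prob (bl k) \<le> \<delta>\<^sup>2 / 12 * (1 / (real (max k 1))\<^sup>2)" for k
    unfolding bf_def bg_def bl_def
    using tail_at[OF Apos(1), of Nf] tail_at[OF Apos(2), of Ng] tail_at[OF Apos(3), of Nl] tails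
    unfolding Af_def Ag_def Al_def by blast+
  define bad where "bad = (\<Union>k<t. bf k \<union> bg k \<union> bl k)"
  have bad_sets: "bad \<in> sets M" unfolding bad_def using b_sets by auto
  have "prob bad \<le> (\<Sum>k<t. prob (bf k \<union> bg k \<union> bl k))"
    unfolding bad_def using b_sets by (intro finite_measure_subadditive_finite) auto
  also have "\<dots> \<le> (\<Sum>k<t. \<delta>\<^sup>2 / 4 * (1 / (real (max k 1))\<^sup>2))"
  proof (rule sum_mono)
    fix k
    have "prob (bf k \<union> bg k \<union> bl k) \<le> prob (bf k) + prob (bg k) + prob (bl k)"
      using measure_Un_le[of "bf k \<union> bg k" M "bl k"] measure_Un_le[of "bf k" M "bg k"] b_sets[of k] by simp
    then show "prob (bf k \<union> bg k \<union> bl k) \<le> \<delta>\<^sup>2 / 4 * (1 / (real (max k 1))\<^sup>2)"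
      using b_prob[of k] by linarith
  qed
  also have "\<dots> = \<delta>\<^sup>2 / 4 * (\<Sum>k<t. 1 / (real (max k 1))\<^sup>2)" by (rule sum_distrib_left[symmetric])
  also have "\<dots> \<le> \<delta>\<^sup>2 / 4 * 3" by (intro mult_left_mono sum_inverse_square_le) simp
  also have "\<dots> \<le> \<delta>"
    using \<delta> mult_left_mono[of \<delta> 1 \<delta>] by (simp add: power2_eq_square)
  finally have bad_prob: "prob bad \<le> \<delta>" .
  have d1: "real d \<ge> 1" using dim_pos by simp
  have arg_t: "6 * real t * real d / \<delta> \<ge> 6"
  proof -
    have "1 * 1 \<le> real t * real d" using t d1 by (intro mult_mono) auto
    then show ?thesis using \<delta> by (simp add: field_simps)
  qed
  have \<zeta>2: "\<zeta>\<^sup>2 = ln (6 * real t * real d / \<delta>)" using arg_t by (simp add: \<zeta>_def)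
  have \<zeta>1: "\<zeta> \<ge> 1"
  proof -
    have "exp 1 \<le> 6 * real t * real d / \<delta>" using exp_le arg_t by linarith
    then have "1 \<le> ln (6 * real t * real d / \<delta>)" using arg_t by (simp add: ln_ge_iff)
    then show ?thesis by (simp add: \<zeta>_def)
  qed
  have logs: "sqrt (2 * \<Lambda> k) \<le> sqrt (2 * ln (6 * real (max k 1) * real d / \<delta>))"
      "sqrt (2 * ln (6 * real (max k 1) * real d / \<delta>)) \<le> sqrt 2 * \<zeta>" if k: "k < t" for k
  proof -
    have m: "real (max k 1) * 1 \<le> real (max k 1) * real d" using d1 by (intro mult_left_mono) auto
    then have le: "6 * real (max k 1) / \<delta> \<le> 6 * real (max k 1) * real d / \<delta>"
      using \<delta> by (intro divide_right_mono) auto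
    then show "sqrt (2 * \<Lambda> k) \<le> sqrt (2 * ln (6 * real (max k 1) * real d / \<delta>))"
      using arg[of k] unfolding \<Lambda>_def by (intro real_sqrt_le_mono mult_left_mono ln_mono) linarith+
    have "6 * real (max k 1) * real d / \<delta> \<le> 6 * real t * real d / \<delta>"
      using \<delta> k t by (intro divide_right_mono mult_right_mono) auto
    then have "ln (6 * real (max k 1) * real d / \<delta>) \<le> ln (6 * real t * real d / \<delta>)"
      using arg[of k] le by (intro ln_mono) linarith+
    then have "sqrt (ln (6 * real (max k 1) * real d / \<delta>)) \<le> \<zeta>"
      unfolding \<zeta>_def by (rule real_sqrt_le_mono)
    then show "sqrt (2 * ln (6 * real (max k 1) * real d / \<delta>)) \<le> sqrt 2 * \<zeta>"
      by (simp add: real_sqrt_mult)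
  qed
  have K': "K k = 5 * ((2 * Ll * D + 3 / 2 * \<sigma>l) * sqrt (2 * \<Lambda> k)
      + D * (2 * Lg * D + 3 / 2 * \<sigma>g) * sqrt (2 * ln (6 * real (max k 1) * real d / \<delta>))) / sqrt (real k + 1)" for k
    unfolding K \<Lambda>_def using powr_minus_divide[of "real k + 1" "1 / 2"] by (simp add: powr_half_sqrt)
  have A'nn: "0 \<le> 2 * Ll * D + 3 / 2 * \<sigma>l" "0 \<le> D * (2 * Lg * D + 3 / 2 * \<sigma>g)"
    using D_nonneg Lg_nonneg Ll_nonneg \<sigma>g_pos \<sigma>l_pos by auto
  have inv: "1 / (real k + 2) \<le> \<zeta> / sqrt (real k + 1)" for k
  proof -
    have "sqrt (real k + 1) \<le> real k + 2" by (rule real_le_lsqrt) (auto simp: power2_eq_square algebra_simps)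
    then have "1 / (real k + 2) \<le> 1 / sqrt (real k + 1)" by (intro divide_left_mono) auto
    also have "\<dots> \<le> \<zeta> / sqrt (real k + 1)" using \<zeta>1 by (intro divide_right_mono) auto
    finally show ?thesis .
  qed
  define Bg where "Bg = 10 * sqrt 2 * (2 * Ll * D + 3 / 2 * \<sigma>l + D * (2 * Lg * D + 3 / 2 * \<sigma>g)) + Lg * D\<^sup>2"
  define Bf where "Bf = 5 * sqrt 2 * D * (2 * Lf * D + \<sigma>f) + Lf * D\<^sup>2"
  have B0: "0 \<le> Bg * \<zeta>" "0 \<le> Bf * \<zeta>"
    unfolding Bg_def Bf_def using \<zeta>1 A'nn D_nonneg Lf_nonneg Lg_nonneg Apos(1)[unfolded Af_def]
    by (auto intro!: mult_nonneg_nonneg add_nonneg_nonneg)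
  have main: "g (x t \<omega>) - g x0 \<le> 2 * Bg * \<zeta> / sqrt (real t + 1)"
      "\<And>z. z \<in> lower_solutions g Z \<Longrightarrow> f (x t \<omega>) - f z \<le> (f x0 - f z) / (real t + 1) + 2 * Bf * \<zeta> / sqrt (real t + 1)"
    if w: "\<omega> \<in> space M" "\<omega> \<notin> bad" for \<omega>
  proof -
    have err: "N \<le> 5 * A * sqrt (2 * \<Lambda> k) / sqrt (real k + 1)" if "\<not> r A k \<le> (real k + 1) * N" for A N k
    proof -
      have "sqrt (real k + 1) * (sqrt (real k + 1) * N) = (real k + 1) * N"
        by (simp add: mult.assoc[symmetric])
      also have "\<dots> \<le> sqrt (real k + 1) * (5 * A * sqrt (2 * \<Lambda> k))"
        using that by (simp add: r_def mult.commute)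
      finally have "sqrt (real k + 1) * N \<le> 5 * A * sqrt (2 * \<Lambda> k)" by simp
      then show ?thesis by (simp add: field_simps)
    qed
    have eNf: "Nf k \<omega> \<le> 5 * Af * sqrt (2 * \<Lambda> k) / sqrt (real k + 1)"
      and eNg: "Ng k \<omega> \<le> 5 * Ag * sqrt (2 * \<Lambda> k) / sqrt (real k + 1)"
      and eNl: "Nl k \<omega> \<le> 5 * Al * sqrt (2 * \<Lambda> k) / sqrt (real k + 1)" if k: "k < t" for k
      using w k by (auto simp: bad_def bf_def bg_def bl_def intro!: err)
    have KN: "Nl k \<omega> + D * Ng k \<omega> \<le> K k" if k: "k < t" for k
    proof -
      have "Nl k \<omega> + D * Ng k \<omega> \<le> 5 * Al * sqrt (2 * \<Lambda> k) / sqrt (real k + 1)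
          + D * (5 * Ag * sqrt (2 * \<Lambda> k) / sqrt (real k + 1))"
        by (intro add_mono mult_left_mono eNg eNl k D_nonneg)
      also have "\<dots> = 5 * (Al * sqrt (2 * \<Lambda> k) + D * Ag * sqrt (2 * \<Lambda> k)) / sqrt (real k + 1)"
        by (simp add: add_divide_distrib distrib_left mult.assoc mult.left_commute)
      also have "\<dots> \<le> K k"
        unfolding K' Al_def Ag_def using logs(1)[OF k] D_nonneg \<sigma>l_pos \<sigma>g_pos \<Lambda>pos[of k] Lg_nonneg Ll_nonneg
        by (intro divide_right_mono mult_left_mono add_mono mult_mono) auto
      finally show ?thesis .
    qed
    have step:
      "(real k + 2) * (g (x (Suc k) \<omega>) - g x0)
        \<le> (real k + 1) * (g (x k \<omega>) - g x0) + (2 * K k + Lg * D\<^sup>2 / (real k + 2))"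
      "(real k + 2) * (f (x (Suc k) \<omega>) - f z)
        \<le> (real k + 1) * (f (x k \<omega>) - f z) + (D * Nf k \<omega> + Lf * D\<^sup>2 / (real k + 2))"
      if k: "k < t" and z: "z \<in> lower_solutions g Z" for k z
      unfolding f_def g_def
      by (rule one_step[OF harmonic f_convex w(1) _ _ Nl N0 KN[OF k] z[unfolded g_def]];
          (rule Nf Ng, assumption+))+
    obtain z0 where z0: "z0 \<in> lower_solutions g Z" using lower_solutions_nonempty g_def by auto
    have "g (x t \<omega>) - g x0 \<le> (g (x 0 \<omega>) - g x0) / (real t + 1) + 2 * (Bg * \<zeta>) / sqrt (real t + 1)"
    proof (rule averaged_recursion_bound[OF _ B0(1)])
      fix k assume k: "k < t"
      have "2 * K k \<le> 10 * ((2 * Ll * D + 3 / 2 * \<sigma>l) * (sqrt 2 * \<zeta>)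
          + D * (2 * Lg * D + 3 / 2 * \<sigma>g) * (sqrt 2 * \<zeta>)) / sqrt (real k + 1)"
      proof -
        have "K k \<le> 5 * ((2 * Ll * D + 3 / 2 * \<sigma>l) * (sqrt 2 * \<zeta>)
          + D * (2 * Lg * D + 3 / 2 * \<sigma>g) * (sqrt 2 * \<zeta>)) / sqrt (real k + 1)"
          unfolding K' using logs(2)[OF k] order_trans[OF logs(1)[OF k] logs(2)[OF k]] A'nn
          by (intro divide_right_mono mult_left_mono add_mono) auto
        moreover have "2 * a \<le> 10 * V / q" if "a \<le> 5 * V / q" for a V q :: real
          using that by simp
        ultimately show ?thesis by blast
      qed
      moreover have "Lg * D\<^sup>2 / (real k + 2) \<le> Lg * D\<^sup>2 * (\<zeta> / sqrt (real k + 1))"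
        using mult_left_mono[OF inv[of k], of "Lg * D\<^sup>2"] Lg_nonneg by simp
      moreover have "Bg * \<zeta> / sqrt (real k + 1) = 10 * ((2 * Ll * D + 3 / 2 * \<sigma>l) * (sqrt 2 * \<zeta>)
          + D * (2 * Lg * D + 3 / 2 * \<sigma>g) * (sqrt 2 * \<zeta>)) / sqrt (real k + 1)
          + Lg * D\<^sup>2 * (\<zeta> / sqrt (real k + 1))"
        by (simp add: Bg_def add_divide_distrib[symmetric]) (simp add: algebra_simps)
      ultimately show "(real k + 2) * (g (x (Suc k) \<omega>) - g x0)
          \<le> (real k + 1) * (g (x k \<omega>) - g x0) + Bg * \<zeta> / sqrt (real k + 1)"
        using step(1)[OF k z0] by linarith
    qed
    then show "g (x t \<omega>) - g x0 \<le> 2 * Bg * \<zeta> / sqrt (real t + 1)"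
      using w by (simp add: x_0 mult.assoc)
    fix z assume z: "z \<in> lower_solutions g Z"
    have "f (x t \<omega>) - f z \<le> (f (x 0 \<omega>) - f z) / (real t + 1) + 2 * (Bf * \<zeta>) / sqrt (real t + 1)"
    proof (rule averaged_recursion_bound[OF _ B0(2)])
      fix k assume k: "k < t"
      have "Nf k \<omega> \<le> 5 * Af * (sqrt 2 * \<zeta>) / sqrt (real k + 1)"
        using eNf[OF k] order_trans[OF logs(1)[OF k] logs(2)[OF k]] Apos
        by (elim order_trans) (intro divide_right_mono mult_left_mono, auto)
      then have "D * Nf k \<omega> \<le> D * (5 * Af * (sqrt 2 * \<zeta>) / sqrt (real k + 1))"
        by (rule mult_left_mono) (rule D_nonneg)
      moreover have "Lf * D\<^sup>2 / (real k + 2) \<le> Lf * D\<^sup>2 * (\<zeta> / sqrt (real k + 1))"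
        using mult_left_mono[OF inv[of k], of "Lf * D\<^sup>2"] Lf_nonneg by simp
      moreover have "Bf * \<zeta> / sqrt (real k + 1) = D * (5 * Af * (sqrt 2 * \<zeta>) / sqrt (real k + 1))
          + Lf * D\<^sup>2 * (\<zeta> / sqrt (real k + 1))"
        by (simp add: Bf_def Af_def add_divide_distrib[symmetric]) (simp add: algebra_simps)
      ultimately show "(real k + 2) * (f (x (Suc k) \<omega>) - f z)
          \<le> (real k + 1) * (f (x k \<omega>) - f z) + Bf * \<zeta> / sqrt (real k + 1)"
        using step(2)[OF k z] by linarith
    qed
    then show "f (x t \<omega>) - f z \<le> (f x0 - f z) / (real t + 1) + 2 * Bf * \<zeta> / sqrt (real t + 1)"
      using w by (simp add: x_0 mult.assoc)
  qed
  have good_sets: "?good \<in> sets M"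
  proof -
    have [measurable]: "(\<lambda>\<omega>. f (x t \<omega>)) \<in> borel_measurable M" "(\<lambda>\<omega>. g (x t \<omega>)) \<in> borel_measurable M"
      unfolding f_def g_def
      by (rule mean_fun_x_measurable[OF harmonic f_convex C1_on_imp_continuous_on[OF upper.mean_C1]]
            mean_fun_x_measurable[OF harmonic f_convex C1_on_imp_continuous_on[OF lower.mean_C1]])+
    show ?thesis by measurable
  qed
  have "space M - bad \<subseteq> ?good"
  proof
    fix \<omega> assume "\<omega> \<in> space M - bad"
    then have w: "\<omega> \<in> space M" "\<omega> \<notin> bad" by auto
    define R where "R = 2 * Bf * \<zeta> / sqrt (real t + 1)"
    \<comment> \<open>the bound for each \<open>z\<close> solved for \<open>f z\<close>, so that it passes to the infimum\<close>
    define c where "c = (f (x t \<omega>) - f x0 / (real t + 1) - R) * ((real t + 1) / real t)"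
    have tp: "real t > 0" using t by simp
    have share: "u * (real t / (real t + 1)) = u - u / (real t + 1)" for u :: real
      by (simp add: field_simps)
    have "c \<le> f z" if z: "z \<in> lower_solutions g Z" for z
    proof -
      have "f (x t \<omega>) - f x0 / (real t + 1) - R \<le> f z * (real t / (real t + 1))"
        using main(2)[OF w z, folded R_def] unfolding share diff_divide_distrib by linarith
      then have "c \<le> f z * (real t / (real t + 1)) * ((real t + 1) / real t)"
        unfolding c_def by (rule mult_right_mono) simp
      also have "\<dots> = f z" using tp by simp
      finally show ?thesis .
    qed
    then have "c \<le> upper_value f g Z"
      unfolding upper_value_def using lower_solutions_nonempty
      by (intro cInf_greatest) (auto simp: g_def)
    then have "c * (real t / (real t + 1)) \<le> upper_value f g Z * (real t / (real t + 1))"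
      by (rule mult_right_mono) simp
    also have "c * (real t / (real t + 1)) = f (x t \<omega>) - f x0 / (real t + 1) - R"
      unfolding c_def using tp by simp
    finally have "f (x t \<omega>) - upper_value f g Z \<le> R + (f x0 - upper_value f g Z) / (real t + 1)"
      unfolding share diff_divide_distrib by linarith
    moreover have "g (x t \<omega>) - lower_value g Z \<le> 2 * Bg * \<zeta> / sqrt (real t + 1) + \<epsilon>g / 2"
      using main(1)[OF w] x0_near_optimal unfolding g_def by linarith
    moreover have "0 \<le> Lg * D\<^sup>2 * ln (real t) / (real t + 1)" "0 \<le> Lf * D\<^sup>2 * ln (real t) / (real t + 1)"
      using Lg_nonneg Lf_nonneg t by auto
    ultimately show "\<omega> \<in> ?good"
      unfolding R_def Bf_def Bg_def add_divide_distrib[of _ "Lf * D\<^sup>2 * ln (real t)"]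
      by (intro CollectI conjI w(1)) linarith+
  qed
  then have "prob (space M - bad) \<le> prob ?good" by (intro finite_measure_mono good_sets)
  then show ?thesis using bad_prob prob_compl[OF bad_sets] by linarith
qed

end

theorem theorem4p4:
  shows "\<exists>(c::real) > 0. \<exists>(C1 :: real \<Rightarrow> real \<Rightarrow> real \<Rightarrow> real \<Rightarrow> real \<Rightarrow> real)
        (C2 :: real \<Rightarrow> real \<Rightarrow> real \<Rightarrow> real).
    \<forall>d Z (P\<theta> :: 'a measure) F dF df (P\<xi> :: 'b measure) G dG dg D Lf Lg Ll \<sigma>f \<sigma>g \<sigma>l
      (M :: 'w measure) \<epsilon>f \<epsilon>g \<alpha> \<beta> \<rho> \<gamma> K x0 \<F> \<theta> \<xi> x s (\<delta>::real).
      sbcgi d Z P\<theta> F dF df P\<xi> G dG dg D Lf Lg Ll \<sigma>f \<sigma>g \<sigma>l M \<epsilon>f \<epsilon>g \<alpha> \<beta> \<rho> \<gamma> K x0 \<F> \<theta> \<xi> x s \<longrightarrow>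
      convex_on Z (mean_fun P\<theta> F) \<longrightarrow>
      0 < \<delta> \<longrightarrow> \<delta> < 1 \<longrightarrow>
      (\<forall>t. \<alpha> t = 1 / (real t + 1) \<and> \<beta> t = 1 / (real t + 1) \<and>
           \<rho> t = 1 / (real t + 1) \<and> \<gamma> t = 1 / (real t + 1)) \<longrightarrow>
      (\<forall>t. K t = c * ((2 * Ll * D + 3 / 2 * \<sigma>l) * sqrt (2 * ln (6 * real (max t 1) / \<delta>))
               + D * (2 * Lg * D + 3 / 2 * \<sigma>g) * sqrt (2 * ln (6 * real (max t 1) * real d / \<delta>)))
             * (real t + 1) powr (- 1 / 2)) \<longrightarrow>
      (\<forall>t\<ge>1.
        let f = mean_fun P\<theta> F; g = mean_fun P\<xi> G;
            f_opt = upper_value f g Z; g_opt = lower_value g Z;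
            \<zeta> = sqrt (ln (6 * real t * real d / \<delta>))
        in measure M {\<omega> \<in> space M.
             g (x t \<omega>) - g_opt \<le> C1 D Lg Ll \<sigma>g \<sigma>l * \<zeta> / sqrt (real t + 1)
               + Lg * D\<^sup>2 * ln (real t) / (real t + 1) + \<epsilon>g / 2 \<and>
             f (x t \<omega>) - f_opt \<le> C2 D Lf \<sigma>f * \<zeta> / sqrt (real t + 1)
               + (f x0 - f_opt + Lf * D\<^sup>2 * ln (real t)) / (real t + 1)}
           \<ge> 1 - \<delta>)"
  unfolding Let_def
  by (rule exI[of _ 5], rule conjI, simp, rule exI[of _ "\<lambda>D Lg Ll \<sigma>g \<sigma>l.
        2 * (10 * sqrt 2 * (2 * Ll * D + 3 / 2 * \<sigma>l + D * (2 * Lg * D + 3 / 2 * \<sigma>g)) + Lg * D\<^sup>2)"],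
      rule exI[of _ "\<lambda>D Lf \<sigma>f. 2 * (5 * sqrt 2 * D * (2 * Lf * D + \<sigma>f) + Lf * D\<^sup>2)"],
      intro allI impI, rule sbcgi.high_probability_bounds) blast+

end
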